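(* There is an absolute constant $c\ge0$ such that the following holds. Let $X$ be a Hilbert space, and let $-A$ be the generator of a strongly continuous semigroup $\mathrm{T}=(T(s))_{s\in\mathbb{R}_+}$ on $X$ such that $$\|T(s)\|\le M(1+s)^\alpha\qquad(s\ge0)$$ with $\alpha\ge0$ and $M\ge1$. Then $$\|f(A)\|\le c\,9^\alpha\,M^2\,\|f\|_{\mathrm{B}^{0,2\alpha}_{\infty,1}(\mathbb{C}_+)}$$ for every $f=\mathcal{L}\mu$, where $\mu$ is a bounded measure on $\mathbb{R}_+$ of compact support.
   Context: Hilbert spaces are complex. $\mathbb{R}_+=[0,\infty)$, $\mathbb{C}_+=\{z:\operatorname{Re}z>0\}$; measures are complex regular Borel measures. $\mathcal{L}\mu(z)=\int_{\mathbb{R}_+}e^{-zs}\mu(\mathrm{d}s)$ is the Laplace transform, and for $f=\mathcal{L}\mu$, $f(A)x:=\int_{\mathbb{R}_+}T(s)x\,\mu(\mathrm{d}s)$ for $x\in X$. For $n\in\mathbb{Z}$ let $\varphi_n:\mathbb{R}_+\to[0,1]$ be the function vanishing outside $[2^{n-1},2^{n+1}]$ with $\varphi_n(s)=2^{-(n-1)}(s-2^{n-1})$ for $2^{n-1}\le s\le2^n$ and $\varphi_n(s)=2^{-n}(2^{n+1}-s)$ for $2^n\le s\le2^{n+1}$, so that $\sum_{n\in\mathbb{Z}}\varphi_n=1$ on $(0,\infty)$. For $s\ge0$ the Besov norm is $$\|f\|_{\mathrm{B}^{0,s}_{\infty,1}(\mathbb{C}_+)}:=|f(\infty)|+\sum_{n<0}\|\mathcal{L}\varphi_n*f\|_{H^\infty(\mathbb{C}_+)}+\sum_{n\ge0}2^{ns}\|\mathcal{L}\varphi_n*f\|_{H^\infty(\mathbb{C}_+)}\in[0,\infty],$$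 where $f(\infty):=\lim_{t\to\infty}f(t)$, $\|\cdot\|_{H^\infty(\mathbb{C}_+)}$ is the supremum norm on $\mathbb{C}_+$, and for $f=\mathcal{L}\mu$ one has $\mathcal{L}\varphi_n*f=\mathcal{L}(\varphi_n\mu)$, with $(\varphi_n\mu)(\mathrm{d}s)=\varphi_n(s)\mu(\mathrm{d}s)$. *)

theory Defs
  imports "HOL-Analysis.Analysis"
begin

section \<open>Complex Hilbert spaces\<close>

text \<open>
  A complex Hilbert space is a real Hilbert space (with the norm and the inner product of the
  library) that carries a complex scalar multiplication extending the real one and a sesquilinear
  form, linear in its first argument, whose real part is the real inner product.
  No separability is assumed.

  In HOL the type standing for the space is fixed before every quantifier of a statement about it,
  so a constant obtained from a bare existential quantifier could depend on the space.
  An absolute constant has to be restricted to a range that does not mention the type,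
  such as \<open>0 \<le> c \<and> c \<le> 2\<close>: an estimate that is monotone in \<open>c\<close> then holds with \<open>c = 2\<close>
  in all spaces simultaneously.
\<close>

class chilbert_space = real_inner + complete_space +
  fixes scaleC :: "complex \<Rightarrow> 'a \<Rightarrow> 'a" (infixr "*\<^sub>C" 75)
    and cinner :: "'a \<Rightarrow> 'a \<Rightarrow> complex"
  assumes scaleC_add_right: "a *\<^sub>C (x + y) = a *\<^sub>C x + a *\<^sub>C y"
    and scaleC_add_left: "(a + b) *\<^sub>C x = a *\<^sub>C x + b *\<^sub>C x"
    and scaleC_scaleC: "a *\<^sub>C (b *\<^sub>C x) = (a * b) *\<^sub>C x"
    and scaleC_of_real: "complex_of_real r *\<^sub>C x = r *\<^sub>R x"
    and cinner_commute: "cinner y x = cnj (cinner x y)"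
    and cinner_add_left: "cinner (x + y) z = cinner x z + cinner y z"
    and cinner_scaleC_left: "cinner (a *\<^sub>C x) y = a * cinner x y"
    and Re_cinner: "Re (cinner x y) = inner x y"

instantiation complex :: chilbert_space
begin

definition scaleC_complex :: "complex \<Rightarrow> complex \<Rightarrow> complex"
  where "scaleC_complex a x = a * x"

definition cinner_complex :: "complex \<Rightarrow> complex \<Rightarrow> complex"
  where "cinner_complex x y = x * cnj y"

instance
  by standard
    (simp_all add: scaleC_complex_def cinner_complex_def algebra_simps scaleR_conv_of_real
      inner_complex_def)

end


section \<open>Strongly continuous semigroups\<close>

text \<open>Only the values \<open>T s\<close> with \<open>s \<ge> 0\<close> matter.\<close>

definition C0_semigroup :: "(real \<Rightarrow> 'a \<Rightarrow> 'a::chilbert_space) \<Rightarrow> bool"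
  where "C0_semigroup T \<longleftrightarrow>
    (\<forall>s\<ge>0. bounded_linear (T s) \<and> (\<forall>a x. T s (a *\<^sub>C x) = a *\<^sub>C T s x)) \<and>
    (\<forall>x. T 0 x = x) \<and>
    (\<forall>s\<ge>0. \<forall>t\<ge>0. \<forall>x. T (s + t) x = T s (T t x)) \<and>
    (\<forall>x. continuous_on {0..} (\<lambda>s. T s x))"

text \<open>Unbounded operators are given by their graphs.\<close>

definition generator :: "(real \<Rightarrow> 'a \<Rightarrow> 'a::chilbert_space) \<Rightarrow> ('a \<times> 'a) set"
  where "generator T = {(x, y). ((\<lambda>t. (T t x - x) /\<^sub>R t) \<longlongrightarrow> y) (at_right 0)}"

definition minus_op :: "('a \<times> 'a) set \<Rightarrow> ('a \<times> 'a::chilbert_space) set"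
  where "minus_op A = {(x, - y) | x y. (x, y) \<in> A}"


section \<open>Complex measures\<close>

text \<open>
  A complex measure on the measurable space underlying \<open>M\<close> is a set function on \<open>sets M\<close>;
  the measure carried by \<open>M\<close> itself is irrelevant. Finite Borel measures on the half-line are
  automatically regular.
\<close>

definition bounded_complex_measure :: "'b measure \<Rightarrow> ('b set \<Rightarrow> complex) \<Rightarrow> bool"
  where "bounded_complex_measure M \<mu> \<longleftrightarrow>
    (\<forall>B :: nat \<Rightarrow> 'b set. range B \<subseteq> sets M \<longrightarrow> disjoint_family B \<longrightarrow>
       (\<lambda>i. \<mu> (B i)) sums \<mu> (\<Union>i. B i)) \<and>
    (\<exists>K. \<forall>B\<in>sets M. cmod (\<mu> B) \<le> K)"

text \<open>
  The positive part in the Jordan decomposition of a real (signed) measure \<open>\<nu>\<close>, i.e.\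
  \<open>\<nu>\<^sup>+(B) = sup {\<nu>(C) | C \<subseteq> B}\<close>; the negative part of \<open>\<nu>\<close> is the positive part of \<open>-\<nu>\<close>.
\<close>

definition positive_part :: "'b measure \<Rightarrow> ('b set \<Rightarrow> real) \<Rightarrow> 'b measure"
  where "positive_part M \<nu> =
    measure_of (space M) (sets M) (\<lambda>B. SUP C\<in>{C \<in> sets M. C \<subseteq> B}. ennreal (\<nu> C))"

definition cm_integral :: "'b measure \<Rightarrow> ('b set \<Rightarrow> complex) \<Rightarrow> ('b \<Rightarrow> complex) \<Rightarrow> complex"
  where "cm_integral M \<mu> g =
    (integral\<^sup>L (positive_part M (\<lambda>B. Re (\<mu> B))) g
      - integral\<^sup>L (positive_part M (\<lambda>B. - Re (\<mu> B))) g)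
    + \<i> * (integral\<^sup>L (positive_part M (\<lambda>B. Im (\<mu> B))) g
      - integral\<^sup>L (positive_part M (\<lambda>B. - Im (\<mu> B))) g)"

text \<open>The measure \<open>g\<mu>\<close>, i.e.\ \<open>(g\<mu>)(ds) = g(s) \<mu>(ds)\<close>.\<close>

definition cm_density :: "'b measure \<Rightarrow> ('b \<Rightarrow> complex) \<Rightarrow> ('b set \<Rightarrow> complex) \<Rightarrow> ('b set \<Rightarrow> complex)"
  where "cm_density M g \<mu> = (\<lambda>B. cm_integral M \<mu> (\<lambda>s. indicator B s * g s))"

text \<open>
  The integral of a Hilbert space valued function, in the weak sense: the library's Bochner integral
  is restricted to second countable spaces. For a bounded continuous function and a bounded
  measure of compact support both integrals agree.
\<close>

definition cm_integral_vec ::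
    "'b measure \<Rightarrow> ('b set \<Rightarrow> complex) \<Rightarrow> ('b \<Rightarrow> 'a) \<Rightarrow> 'a::chilbert_space"
  where "cm_integral_vec M \<mu> g =
    (THE y. \<forall>z. cinner y z = cm_integral M \<mu> (\<lambda>s. cinner (g s) z))"

abbreviation half_line :: "real measure"
  where "half_line \<equiv> restrict_space borel {0..}"

definition compact_support :: "(real set \<Rightarrow> complex) \<Rightarrow> bool"
  where "compact_support \<mu> \<longleftrightarrow>
    (\<exists>K. compact K \<and> K \<subseteq> {0..} \<and> (\<forall>B\<in>sets half_line. B \<inter> K = {} \<longrightarrow> \<mu> B = 0))"


section \<open>Laplace transform, functional calculus and Besov norm\<close>

definition laplace :: "(real set \<Rightarrow> complex) \<Rightarrow> complex \<Rightarrow> complex"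
  where "laplace \<mu> z = cm_integral half_line \<mu> (\<lambda>s. exp (- z * of_real s))"

text \<open>The operator \<open>f(A)\<close> for \<open>f = laplace \<mu>\<close>, where \<open>-A\<close> generates \<open>T\<close>.\<close>

definition phillips_calculus ::
    "(real \<Rightarrow> 'a \<Rightarrow> 'a) \<Rightarrow> (real set \<Rightarrow> complex) \<Rightarrow> 'a \<Rightarrow> 'a::chilbert_space"
  where "phillips_calculus T \<mu> x = cm_integral_vec half_line \<mu> (\<lambda>s. T s x)"

definition Hinf_norm :: "(complex \<Rightarrow> complex) \<Rightarrow> ennreal"
  where "Hinf_norm f = (SUP z\<in>{z. Re z > 0}. ennreal (cmod (f z)))"

definition phi :: "int \<Rightarrow> real \<Rightarrow> real"
  where "phi n s =
    (if 2 powi (n - 1) \<le> s \<and> s \<le> 2 powi n then (s - 2 powi (n - 1)) / 2 powi (n - 1)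
     else if 2 powi n \<le> s \<and> s \<le> 2 powi (n + 1) then (2 powi (n + 1) - s) / 2 powi n
     else 0)"

text \<open>
  The Besov norm of order \<open>s\<close> of \<open>f = laplace \<mu>\<close>. The convolution of the Laplace transform of
  \<open>phi n\<close> with \<open>f\<close> is the Laplace transform of the measure \<open>(phi n) \<mu>\<close>. As \<open>f\<close> determines
  \<open>\<mu>\<close>, this is a function of \<open>f\<close>; it is parametrised by \<open>\<mu>\<close> for convenience.
\<close>

definition besov_norm :: "real \<Rightarrow> (real set \<Rightarrow> complex) \<Rightarrow> ennreal"
  where "besov_norm s \<mu> =
    (let h = (\<lambda>n. Hinf_norm (laplace (cm_density half_line (\<lambda>t. of_real (phi n t)) \<mu>)))
     in ennreal (cmod (Lim at_top (\<lambda>t::real. laplace \<mu> (of_real t))))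
        + (\<Sum>\<^sub>\<infinity>n\<in>{n::int. n < 0}. h n)
        + (\<Sum>\<^sub>\<infinity>n\<in>{n::int. n \<ge> 0}. ennreal (2 powr (real_of_int n * s)) * h n))"

end

theory Submission
  imports Defs
begin

text \<open>
  Let \<open>a = 2 powi (n - 1)\<close> and \<open>g(s) = \<langle>T(s)x, y\<rangle>\<close>. For every \<open>s\<close> in \<open>[a, 4a]\<close>, the support of \<open>phi n\<close>,
  \<open>g(s)\<close> is the average over \<open>t\<close> in \<open>[0, a]\<close> of \<open>\<langle>T(s - t)x, T(t)\<^sup>* y\<rangle>\<close>, hence a convolution of two
  orbits of lengths \<open>4a\<close> and \<open>a\<close>. By Plancherel and Cauchy-Schwarz its Fourier transform has \<open>L\<^sup>1\<close> norm at
  most \<open>2 C\<^sub>1 C\<^sub>2 \<parallel>x\<parallel> \<parallel>y\<parallel>\<close>, where \<open>C\<^sub>1\<close> and \<open>C\<^sub>2\<close> bound \<open>T\<close> on \<open>[0, a]\<close> and \<open>[0, 4a]\<close>. So integrating \<open>g\<close>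
  against \<open>(phi n) \<mu>\<close> costs at most this factor times the supremum of the Laplace transform of
  \<open>(phi n) \<mu>\<close> on the imaginary axis; since \<open>(1 + a)(1 + 4a) \<le> 9 max(1, 4^n)\<close>, summing over \<open>n\<close> gives the
  Besov norm. The atom of \<open>\<mu>\<close> at \<open>0\<close> is \<open>f(\<infinity>)\<close>.

  The Fourier argument is carried out on the grid \<open>(a/N)\<int>\<close> with period \<open>5a\<close>: there the convolution
  identity is an exact finite sum, no vector-valued integration is needed, and the Fejer mean of
  the sampled function recovers \<open>g\<close> uniformly on \<open>[a, 4a]\<close> as \<open>N\<close> grows.
\<close>

section \<open>Bounded measurable functions\<close>

text \<open>Such functions are integrable for every finite measure on the sigma-algebra of
  \<open>M\<close>, so one condition serves all four Jordan parts of a complex measure at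
  once.\<close>

definition bdd_measurable :: "'b measure \<Rightarrow> ('b \<Rightarrow> complex) \<Rightarrow> bool"
  where "bdd_measurable M g \<longleftrightarrow> g \<in> borel_measurable M \<and> (\<exists>C. \<forall>s\<in>space M. cmod (g s) \<le> C)"

lemma bdd_measurableI:
  assumes "g \<in> borel_measurable M" "\<And>s. s \<in> space M \<Longrightarrow> cmod (g s) \<le> C"
  shows "bdd_measurable M g"
  using assms unfolding bdd_measurable_def by blast

lemma bdd_measurable_add:
  assumes "bdd_measurable M f" "bdd_measurable M g"
  shows "bdd_measurable M (\<lambda>s. f s + g s)"
proof -
  obtain C D where "\<forall>s\<in>space M. cmod (f s) \<le> C" "\<forall>s\<in>space M. cmod (g s) \<le> D"
    using assms unfolding bdd_measurable_def by blast
  then have "cmod (f s + g s) \<le> C + D" if "s \<in> space M" for s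
    using that norm_triangle_le add_mono by metis
  then show ?thesis
    using assms by (intro bdd_measurableI) (auto simp: bdd_measurable_def)
qed

lemma bdd_measurable_mult:
  assumes "bdd_measurable M f" "bdd_measurable M g"
  shows "bdd_measurable M (\<lambda>s. f s * g s)"
proof -
  obtain C D where C: "\<forall>s\<in>space M. cmod (f s) \<le> C" and D: "\<forall>s\<in>space M. cmod (g s) \<le> D"
    using assms unfolding bdd_measurable_def by blast
  have "cmod (f s * g s) \<le> C * D" if "s \<in> space M" for s
    unfolding norm_mult using C D that by (intro mult_mono) (auto intro: order_trans[OF norm_ge_zero])
  then show ?thesis
    using assms by (intro bdd_measurableI) (auto simp: bdd_measurable_def)
qed

lemma bdd_measurable_const [simp]: "bdd_measurable M (\<lambda>s. c)"
  by (rule bdd_measurableI[where C = "cmod c"]) auto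

lemma bdd_measurable_diff:
  assumes "bdd_measurable M f" "bdd_measurable M g"
  shows "bdd_measurable M (\<lambda>s. f s - g s)"
  using bdd_measurable_add[OF assms(1) bdd_measurable_mult[OF bdd_measurable_const[of M "-1"] assms(2)]]
  by simp

lemma bdd_measurable_sum:
  assumes "\<And>i. i \<in> S \<Longrightarrow> bdd_measurable M (f i)"
  shows "bdd_measurable M (\<lambda>s. \<Sum>i\<in>S. f i s)"
  using assms by (induction S rule: infinite_finite_induct) (auto intro: bdd_measurable_add)

lemma bdd_measurable_indicator: "B \<in> sets M \<Longrightarrow> bdd_measurable M (indicator B)"
  by (rule bdd_measurableI[where C = 1]) (auto simp: indicator_def)

lemma (in finite_measure) bdd_measurable_integrable:
  assumes "bdd_measurable N g" "sets M = sets N"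
  shows "integrable M g"
proof -
  obtain C where "g \<in> borel_measurable N" "\<forall>s\<in>space N. cmod (g s) \<le> C"
    using assms unfolding bdd_measurable_def by blast
  then show ?thesis
    using assms(2) sets_eq_imp_space_eq[OF assms(2)]
    by (intro integrable_const_bound[where B = C]) (auto simp: measurable_cong_sets[OF assms(2) refl])
qed

subsection \<open>Complex measures\<close>

text \<open>The bound \<open>K\<close> is a parameter so that \<open>- \<nu>\<close> is an instance
  with the same bound and every result transfers to the negative part.\<close>

locale signed_measure =
  fixes M :: "'b measure" and \<nu> :: "'b set \<Rightarrow> real" and K :: real
  assumes sums: "range B \<subseteq> sets M \<Longrightarrow> disjoint_family B \<Longrightarrow> (\<lambda>i::nat. \<nu> (B i)) sums \<nu> (\<Union>i. B i)"
    and bounded: "A \<in> sets M \<Longrightarrow> \<bar>\<nu> A\<bar> \<le> K"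
begin

lemma empty: "\<nu> {} = 0"
proof -
  have "(\<lambda>i::nat. \<nu> {}) sums \<nu> (\<Union>i::nat. {})"
    by (rule sums) (auto simp: disjoint_family_on_def)
  then have "summable (\<lambda>i::nat. \<nu> {})"
    by (rule sums_summable)
  then show ?thesis
    by (simp add: summable_const_iff)
qed

lemma Un:
  assumes "A \<in> sets M" "B \<in> sets M" "A \<inter> B = {}"
  shows "\<nu> (A \<union> B) = \<nu> A + \<nu> B"
proof -
  have "(\<lambda>i. \<nu> (binaryset A B i)) sums \<nu> (\<Union>i. binaryset A B i)"
    by (rule sums) (use assms in \<open>auto simp: range_binaryset_eq disjoint_family_on_def binaryset_def\<close>)
  moreover have "(\<lambda>i. \<nu> (binaryset A B i)) sums (\<nu> A + \<nu> B)"
    by (rule binaryset_sums) (rule empty)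
  ultimately show ?thesis
    by (simp add: UN_binaryset_eq sums_unique2)
qed

lemma uminus: "signed_measure M (\<lambda>B. - \<nu> B) K"
  by unfold_locales (auto simp: sums_minus sums bounded)

text \<open>Clipping by \<open>ennreal\<close> sends negative values to 0, which the competitor
  \<open>C = {}\<close> attains anyway, so this is the supremum of \<open>\<nu> C\<close>
  itself.\<close>

definition pos :: "'b set \<Rightarrow> ennreal"
  where "pos B = (SUP C\<in>{C \<in> sets M. C \<subseteq> B}. ennreal (\<nu> C))"

lemma le_pos: "C \<in> sets M \<Longrightarrow> C \<subseteq> B \<Longrightarrow> ennreal (\<nu> C) \<le> pos B"
  unfolding pos_def by (rule SUP_upper) simp

lemma pos_mono: "A \<subseteq> B \<Longrightarrow> pos A \<le> pos B"
  unfolding pos_def by (rule SUP_subset_mono) auto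

lemma pos_le: "pos B \<le> ennreal K"
  unfolding pos_def
proof (rule SUP_least)
  fix C assume "C \<in> {C \<in> sets M. C \<subseteq> B}"
  then show "ennreal (\<nu> C) \<le> ennreal K"
    using bounded[of C] by (intro ennreal_leI) simp
qed

text \<open>Competitors \<open>C \<subseteq> A\<close> and \<open>D \<subseteq> B\<close> combine to
  the competitor \<open>C \<union> D\<close> for the union.\<close>

lemma pos_superadditive:
  assumes "A \<in> sets M" "B \<in> sets M" "A \<inter> B = {}"
  shows "pos A + pos B \<le> pos (A \<union> B)"
proof -
  have le: "ennreal (\<nu> C) + ennreal (\<nu> D) \<le> pos (A \<union> B)"
    if "C \<in> sets M" "C \<subseteq> A" "D \<in> sets M" "D \<subseteq> B" for C D
  proof (cases "0 \<le> \<nu> C \<and> 0 \<le> \<nu> D")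
    case True
    have "\<nu> (C \<union> D) = \<nu> C + \<nu> D"
      by (rule Un) (use that assms in auto)
    then have "ennreal (\<nu> C) + ennreal (\<nu> D) = ennreal (\<nu> (C \<union> D))"
      using True by simp
    also have "\<dots> \<le> pos (A \<union> B)"
      by (rule le_pos) (use that in auto)
    finally show ?thesis .
  next
    \<comment> \<open>A negative value is clipped to 0, and the remaining set alone is a
      competitor.\<close>
    case False
    have "ennreal (\<nu> C) \<le> pos (A \<union> B)" "ennreal (\<nu> D) \<le> pos (A \<union> B)"
      by (rule le_pos; use that in auto)+
    with False show ?thesis
      by (auto simp: ennreal_neg not_le)
  qed
  have "pos A + pos B = (SUP C\<in>{C \<in> sets M. C \<subseteq> A}. ennreal (\<nu> C) + pos B)"
    unfolding pos_def[of A] by (rule ennreal_SUP_add_left[symmetric]) auto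
  also have "\<dots> \<le> pos (A \<union> B)"
  proof (rule SUP_least)
    fix C assume C: "C \<in> {C \<in> sets M. C \<subseteq> A}"
    have "ennreal (\<nu> C) + pos B = (SUP D\<in>{D \<in> sets M. D \<subseteq> B}. ennreal (\<nu> C) + ennreal (\<nu> D))"
      unfolding pos_def[of B] by (rule ennreal_SUP_add_right) auto
    also have "\<dots> \<le> pos (A \<union> B)"
      by (rule SUP_least) (use C le in auto)
    finally show "ennreal (\<nu> C) + pos B \<le> pos (A \<union> B)" .
  qed
  finally show ?thesis .
qed

text \<open>One inequality is superadditivity on the partial unions. For the other, a competitor
  \<open>C\<close> for the whole union is cut into the pieces \<open>C \<inter> A i\<close>, each a
  competitor for \<open>A i\<close>.\<close>

lemma countably_additive_pos: "countably_additive (sets M) pos"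
proof (rule countably_additiveI)
  fix A :: "nat \<Rightarrow> 'b set"
  assume A: "range A \<subseteq> sets M" "disjoint_family A" "(\<Union>i. A i) \<in> sets M"
  have fin: "(\<Sum>i<n. pos (A i)) \<le> pos (\<Union>i<n. A i)" for n
  proof (induction n)
    case 0
    then show ?case by simp
  next
    case (Suc n)
    have "(\<Sum>i<Suc n. pos (A i)) \<le> pos (\<Union>i<n. A i) + pos (A n)"
      using Suc by (simp add: add_mono)
    also have "\<dots> \<le> pos ((\<Union>i<n. A i) \<union> A n)"
    proof (rule pos_superadditive)
      have "A i \<inter> A n = {}" if "i < n" for i
        using disjoint_family_onD[OF A(2), of i n] that by auto
      then show "(\<Union>i<n. A i) \<inter> A n = {}"
        by blast
    qed (use A(1) in auto)
    also have "(\<Union>i<n. A i) \<union> A n = (\<Union>i<Suc n. A i)"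
      by (auto simp: lessThan_Suc)
    finally show ?case .
  qed
  have "(\<Sum>i. pos (A i)) \<le> pos (\<Union>i. A i)"
  proof (rule suminf_le_const)
    fix n
    have "(\<Sum>i<n. pos (A i)) \<le> pos (\<Union>i<n. A i)"
      by (rule fin)
    also have "\<dots> \<le> pos (\<Union>i. A i)"
      by (rule pos_mono) auto
    finally show "(\<Sum>i<n. pos (A i)) \<le> pos (\<Union>i. A i)" .
  qed simp
  moreover have "pos (\<Union>i. A i) \<le> (\<Sum>i. pos (A i))"
    unfolding pos_def[of "\<Union>i. A i"]
  proof (rule SUP_least)
    fix C assume C: "C \<in> {C \<in> sets M. C \<subseteq> (\<Union>i. A i)}"
    have "(\<lambda>i. \<nu> (C \<inter> A i)) sums \<nu> (\<Union>i. C \<inter> A i)"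
      by (rule sums) (use A C in \<open>auto simp: disjoint_family_on_def\<close>)
    also have "(\<Union>i. C \<inter> A i) = C"
      using C by auto
    finally have "(\<lambda>n. \<Sum>i<n. \<nu> (C \<inter> A i)) \<longlonglongrightarrow> \<nu> C"
      by (simp add: sums_def)
    then have "(\<lambda>n. ennreal (\<Sum>i<n. \<nu> (C \<inter> A i))) \<longlonglongrightarrow> ennreal (\<nu> C)"
      by (rule tendsto_ennrealI)
    then show "ennreal (\<nu> C) \<le> (\<Sum>i. pos (A i))"
    proof (rule LIMSEQ_le_const2, intro exI allI impI)
      fix n
      \<comment> \<open>\<open>ennreal\<close> is additive only on nonnegative terms, so negative
        pieces are replaced by 0 before it is distributed over the sum.\<close>
      have "ennreal (\<Sum>i<n. \<nu> (C \<inter> A i)) \<le> ennreal (\<Sum>i<n. max 0 (\<nu> (C \<inter> A i)))"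
        by (intro ennreal_leI sum_mono) simp
      also have "\<dots> = (\<Sum>i<n. ennreal (max 0 (\<nu> (C \<inter> A i))))"
        by (rule sum_ennreal[symmetric]) simp
      also have "\<dots> \<le> (\<Sum>i<n. pos (A i))"
      proof (rule sum_mono)
        fix i
        have "ennreal (\<nu> (C \<inter> A i)) \<le> pos (A i)"
          by (rule le_pos) (use C A in auto)
        then show "ennreal (max 0 (\<nu> (C \<inter> A i))) \<le> pos (A i)"
          by (simp add: max_def ennreal_neg)
      qed
      also have "\<dots> \<le> (\<Sum>i. pos (A i))"
        by (rule sum_le_suminf) auto
      finally show "ennreal (\<Sum>i<n. \<nu> (C \<inter> A i)) \<le> (\<Sum>i. pos (A i))" .
    qed
  qed
  ultimately show "(\<Sum>i. pos (A i)) = pos (\<Union>i. A i)"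
    by (rule antisym)
qed

lemma sets_positive_part [simp]: "sets (positive_part M \<nu>) = sets M"
  and space_positive_part [simp]: "space (positive_part M \<nu>) = space M"
  by (simp_all add: positive_part_def sets.space_closed)

lemma emeasure_positive_part:
  assumes "B \<in> sets M"
  shows "emeasure (positive_part M \<nu>) B = pos B"
proof (rule emeasure_measure_of[where M = "positive_part M \<nu>" and A = "sets M" and \<Omega> = "space M"])
  show "positive_part M \<nu> = measure_of (space M) (sets M) pos"
    by (simp add: positive_part_def pos_def[abs_def])
  show "positive (sets (positive_part M \<nu>)) pos"
    by (simp add: positive_def pos_def empty)
  show "countably_additive (sets (positive_part M \<nu>)) pos"
    using countably_additive_pos by simp
qed (use assms sets.space_closed in auto)

lemma finite_positive_part: "finite_measure (positive_part M \<nu>)"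
proof (rule finite_measureI)
  show "emeasure (positive_part M \<nu>) (space (positive_part M \<nu>)) \<noteq> \<infinity>"
    using pos_le[of "space M"]
    by (auto simp: emeasure_positive_part top_unique)
qed

lemma le_measure_positive_part:
  assumes "B \<in> sets M" "C \<in> sets M" "C \<subseteq> B"
  shows "\<nu> C \<le> measure (positive_part M \<nu>) B"
proof -
  interpret p: finite_measure "positive_part M \<nu>"
    by (rule finite_positive_part)
  have "ennreal (\<nu> C) \<le> ennreal (measure (positive_part M \<nu>) B)"
    using le_pos[of C B] assms by (simp add: emeasure_positive_part flip: p.emeasure_eq_measure)
  then show ?thesis
    by (simp add: ennreal_le_iff)
qed

lemma measure_positive_part_le:
  assumes "B \<in> sets M" "\<And>C. C \<in> sets M \<Longrightarrow> C \<subseteq> B \<Longrightarrow> \<nu> C \<le> c"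
  shows "measure (positive_part M \<nu>) B \<le> c"
proof -
  have "emeasure (positive_part M \<nu>) B \<le> ennreal c"
    unfolding emeasure_positive_part[OF assms(1)] pos_def
    by (rule SUP_least) (auto intro!: ennreal_leI assms(2))
  moreover have "0 \<le> c"
    using assms(2)[of "{}"] by (simp add: empty)
  ultimately show ?thesis
    unfolding measure_def by (metis enn2real_leI)
qed

text \<open>Jordan decomposition without a Hahn set: taking the supremum over \<open>C\<close> in
  \<open>\<nu> C = \<nu> B - \<nu> (B - C)\<close> bounds the positive part by
  \<open>\<nu> B\<close> plus the negative part. The same argument for \<open>- \<nu>\<close> gives
  the reverse inequality.\<close>

lemma positive_part_diff:
  assumes "B \<in> sets M"
  shows "measure (positive_part M \<nu>) B - measure (positive_part M (\<lambda>B. - \<nu> B)) B = \<nu> B"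
proof -
  interpret n: signed_measure M "\<lambda>B. - \<nu> B" K
    by (rule uminus)
  have split: "\<nu> B = \<nu> C + \<nu> (B - C)" if "C \<in> sets M" "C \<subseteq> B" for C
    using Un[of C "B - C"] that assms by (simp add: Un_absorb1)
  have "measure (positive_part M \<nu>) B \<le> \<nu> B + measure (positive_part M (\<lambda>B. - \<nu> B)) B"
  proof (rule measure_positive_part_le[OF assms])
    fix C assume C: "C \<in> sets M" "C \<subseteq> B"
    show "\<nu> C \<le> \<nu> B + measure (positive_part M (\<lambda>B. - \<nu> B)) B"
      using split[OF C] n.le_measure_positive_part[of B "B - C"] assms C by auto
  qed
  moreover have "measure (positive_part M (\<lambda>B. - \<nu> B)) B \<le> - \<nu> B + measure (positive_part M \<nu>) B"
  proof (rule n.measure_positive_part_le[OF assms])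
    fix C assume C: "C \<in> sets M" "C \<subseteq> B"
    show "- \<nu> C \<le> - \<nu> B + measure (positive_part M \<nu>) B"
      using split[OF C] le_measure_positive_part[of B "B - C"] assms C by auto
  qed
  ultimately show ?thesis
    by linarith
qed


section \<open>Integration against a signed measure\<close>

definition sintegral :: "('b \<Rightarrow> complex) \<Rightarrow> complex"
  where "sintegral g = integral\<^sup>L (positive_part M \<nu>) g - integral\<^sup>L (positive_part M (\<lambda>B. - \<nu> B)) g"

definition tv :: real
  where "tv = measure (positive_part M \<nu>) (space M) + measure (positive_part M (\<lambda>B. - \<nu> B)) (space M)"

lemma integrable_pos: "bdd_measurable M g \<Longrightarrow> integrable (positive_part M \<nu>) g"
  by (rule finite_measure.bdd_measurable_integrable[OF finite_positive_part]) auto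

lemma integrable_neg: "bdd_measurable M g \<Longrightarrow> integrable (positive_part M (\<lambda>B. - \<nu> B)) g"
  by (rule signed_measure.integrable_pos[OF uminus])

lemma sintegral_add: "bdd_measurable M f \<Longrightarrow> bdd_measurable M g \<Longrightarrow> sintegral (\<lambda>s. f s + g s) = sintegral f + sintegral g"
  by (simp add: sintegral_def integrable_pos integrable_neg)

lemma sintegral_cmult: "sintegral (\<lambda>s. c * g s) = c * sintegral g"
  by (simp add: sintegral_def algebra_simps)

lemma sintegral_indicator:
  assumes "B \<in> sets M"
  shows "sintegral (indicator B) = of_real (\<nu> B)"
proof -
  interpret n: signed_measure M "\<lambda>B. - \<nu> B" K
    by (rule uminus)
  have B: "B \<inter> space M = B"
    using assms sets.sets_into_space by blast
  have *: "integral\<^sup>L N (indicator B :: _ \<Rightarrow> complex) = of_real (measure N (B \<inter> space N))" for N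
  proof -
    have "integral\<^sup>L N (indicator B :: _ \<Rightarrow> complex) = integral\<^sup>L N (\<lambda>s. of_real (indicator B s))"
      by (rule Bochner_Integration.integral_cong) (auto simp: indicator_def)
    also have "\<dots> = of_real (measure N (B \<inter> space N))"
      by (subst integral_complex_of_real) simp
    finally show ?thesis .
  qed
  show ?thesis
    using positive_part_diff[OF assms] by (simp add: sintegral_def * B flip: of_real_diff)
qed

lemma sintegral_bound:
  assumes "bdd_measurable M g" "\<And>s. s \<in> space M \<Longrightarrow> cmod (g s) \<le> C"
  shows "cmod (sintegral g) \<le> tv * C"
proof -
  interpret n: signed_measure M "\<lambda>B. - \<nu> B" K
    by (rule uminus)
  have *: "cmod (integral\<^sup>L N g) \<le> measure N (space M) * C"
    if "finite_measure N" "sets N = sets M" for N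
  proof -
    interpret finite_measure N by fact
    have sp: "space N = space M"
      by (rule sets_eq_imp_space_eq) fact
    have "integrable N g"
      by (rule bdd_measurable_integrable) fact+
    then have "cmod (integral\<^sup>L N g) \<le> integral\<^sup>L N (\<lambda>s. C)"
      using assms(2) sp
      by (intro order_trans[OF integral_norm_bound] integral_mono) (auto simp: integrable_norm)
    then show ?thesis
      by (simp add: sp)
  qed
  have "cmod (sintegral g) \<le> cmod (integral\<^sup>L (positive_part M \<nu>) g)
      + cmod (integral\<^sup>L (positive_part M (\<lambda>B. - \<nu> B)) g)"
    unfolding sintegral_def by (rule norm_triangle_ineq4)
  also have "\<dots> \<le> tv * C"
    using *[OF finite_positive_part] *[OF n.finite_positive_part]
    by (simp add: tv_def distrib_right add_mono)
  finally show ?thesis .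
qed

lemma sintegral_tendsto:
  assumes "\<And>n::nat. bdd_measurable M (g n)" "bdd_measurable M f"
    and "\<And>n s. s \<in> space M \<Longrightarrow> cmod (g n s) \<le> C"
    and "\<And>s. s \<in> space M \<Longrightarrow> (\<lambda>n. g n s) \<longlonglongrightarrow> f s"
  shows "(\<lambda>n. sintegral (g n)) \<longlonglongrightarrow> sintegral f"
proof -
  interpret n: signed_measure M "\<lambda>B. - \<nu> B" K
    by (rule uminus)
  have *: "(\<lambda>n. integral\<^sup>L N (g n)) \<longlonglongrightarrow> integral\<^sup>L N f"
    if "finite_measure N" "sets N = sets M" for N
  proof (rule integral_dominated_convergence[where w = "\<lambda>_. C"])
    interpret finite_measure N by fact
    have sp: "space N = space M"
      by (rule sets_eq_imp_space_eq) fact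
    show "f \<in> borel_measurable N" "g n \<in> borel_measurable N" for n
      using assms(1,2) by (auto simp: bdd_measurable_def measurable_cong_sets[OF that(2) refl])
    show "integrable N (\<lambda>_. C)"
      by simp
  qed (use assms that(2) sets_eq_imp_space_eq[OF that(2)] in auto)
  show ?thesis
    unfolding sintegral_def
    by (intro tendsto_diff * finite_positive_part n.finite_positive_part) auto
qed

text \<open>A set on all of whose measurable subsets \<open>\<nu>\<close> vanishes is null for both
  Jordan parts. Since \<open>f\<close> is merely measurable, an orbit that grows beyond the support
  of the measure may be replaced by a bounded function.\<close>

lemma sintegral_cong_null:
  assumes "bdd_measurable M g" "N \<in> sets M" "\<And>B. B \<in> sets M \<Longrightarrow> B \<subseteq> N \<Longrightarrow> \<nu> B = 0"
    and "f \<in> borel_measurable M" "\<And>s. s \<in> space M \<Longrightarrow> s \<notin> N \<Longrightarrow> f s = g s"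
  shows "sintegral f = sintegral g"
proof -
  interpret n: signed_measure M "\<lambda>B. - \<nu> B" K
    by (rule uminus)
  have *: "integral\<^sup>L P f = integral\<^sup>L P g"
    if "sets P = sets M" "emeasure P N = 0" for P
  proof (rule integral_cong_AE)
    show "AE s in P. f s = g s"
    proof (rule AE_I)
      show "{s \<in> space P. f s \<noteq> g s} \<subseteq> N"
        using assms(5) sets_eq_imp_space_eq[OF that(1)] by auto
    qed (use that assms in auto)
  qed (use assms in \<open>auto simp: bdd_measurable_def measurable_cong_sets[OF that(1) refl]\<close>)
  have "pos N \<le> 0" "n.pos N \<le> 0"
    unfolding pos_def n.pos_def by (rule SUP_least; use assms(3) in simp)+
  then show ?thesis
    unfolding sintegral_def using *[of "positive_part M \<nu>"] *[of "positive_part M (\<lambda>B. - \<nu> B)"]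
    by (simp add: emeasure_positive_part n.emeasure_positive_part assms(2))
qed

end

section \<open>Integration against a complex measure\<close>

locale complex_measure =
  fixes M :: "'b measure" and \<mu> :: "'b set \<Rightarrow> complex"
  assumes bounded_complex_measure: "bounded_complex_measure M \<mu>"
begin

text \<open>A fixed choice of bound, which the interpretations of the real and imaginary parts take
  as their parameter.\<close>

definition bd :: real where "bd = (SOME K. \<forall>B\<in>sets M. cmod (\<mu> B) \<le> K)"

lemma cmod_le_bd: "B \<in> sets M \<Longrightarrow> cmod (\<mu> B) \<le> bd"
  using bounded_complex_measure someI_ex[of "\<lambda>K. \<forall>B\<in>sets M. cmod (\<mu> B) \<le> K"]
  unfolding bounded_complex_measure_def bd_def by blast

sublocale re: signed_measure M "\<lambda>B. Re (\<mu> B)" bd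
proof
  fix B :: "nat \<Rightarrow> 'b set" assume "range B \<subseteq> sets M" "disjoint_family B"
  then show "(\<lambda>i. Re (\<mu> (B i))) sums Re (\<mu> (\<Union>i. B i))"
    using bounded_complex_measure unfolding bounded_complex_measure_def by (intro sums_Re) blast
next
  fix B assume "B \<in> sets M"
  then show "\<bar>Re (\<mu> B)\<bar> \<le> bd"
    using cmod_le_bd[of B] abs_Re_le_cmod order_trans by blast
qed

sublocale im: signed_measure M "\<lambda>B. Im (\<mu> B)" bd
proof
  fix B :: "nat \<Rightarrow> 'b set" assume "range B \<subseteq> sets M" "disjoint_family B"
  then show "(\<lambda>i. Im (\<mu> (B i))) sums Im (\<mu> (\<Union>i. B i))"
    using bounded_complex_measure unfolding bounded_complex_measure_def by (intro sums_Im) blast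
next
  fix B assume "B \<in> sets M"
  then show "\<bar>Im (\<mu> B)\<bar> \<le> bd"
    using cmod_le_bd[of B] abs_Im_le_cmod order_trans by blast
qed


lemma cm_integral_eq: "cm_integral M \<mu> g = re.sintegral g + \<i> * im.sintegral g"
  by (simp add: cm_integral_def re.sintegral_def im.sintegral_def)

lemma cm_integral_add:
  "bdd_measurable M f \<Longrightarrow> bdd_measurable M g \<Longrightarrow>
    cm_integral M \<mu> (\<lambda>s. f s + g s) = cm_integral M \<mu> f + cm_integral M \<mu> g"
  by (simp add: cm_integral_eq re.sintegral_add im.sintegral_add algebra_simps)

lemma cm_integral_cmult: "cm_integral M \<mu> (\<lambda>s. c * g s) = c * cm_integral M \<mu> g"
  by (simp add: cm_integral_eq re.sintegral_cmult im.sintegral_cmult algebra_simps)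

lemma cm_integral_zero [simp]: "cm_integral M \<mu> (\<lambda>s. 0) = 0"
  using cm_integral_cmult[of 0] by simp

lemma cm_integral_diff:
  assumes "bdd_measurable M f" "bdd_measurable M g"
  shows "cm_integral M \<mu> (\<lambda>s. f s - g s) = cm_integral M \<mu> f - cm_integral M \<mu> g"
  using cm_integral_add[OF assms(1) bdd_measurable_mult[OF bdd_measurable_const[of M "-1"] assms(2)]]
    cm_integral_cmult[of "-1" g]
  by simp

lemma cm_integral_sum:
  assumes "\<And>i. i \<in> S \<Longrightarrow> bdd_measurable M (f i)"
  shows "cm_integral M \<mu> (\<lambda>s. \<Sum>i\<in>S. f i s) = (\<Sum>i\<in>S. cm_integral M \<mu> (f i))"
  using assms
  by (induction S rule: infinite_finite_induct) (auto simp: cm_integral_add bdd_measurable_sum)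

lemma cm_integral_indicator:
  assumes "B \<in> sets M"
  shows "cm_integral M \<mu> (indicator B) = \<mu> B"
  using assms by (simp add: cm_integral_eq re.sintegral_indicator im.sintegral_indicator complex_eq[symmetric])

text \<open>The sum of the variations of the real and imaginary parts. It dominates the total
  variation of \<open>\<mu>\<close>, and it enters only finiteness arguments and error terms, never
  the final constant.\<close>

definition tv :: real
  where "tv = re.tv + im.tv"

lemma tv_nonneg: "0 \<le> tv"
  by (simp add: tv_def re.tv_def im.tv_def)

lemma cm_integral_bound:
  assumes "bdd_measurable M g" "\<And>s. s \<in> space M \<Longrightarrow> cmod (g s) \<le> C"
  shows "cmod (cm_integral M \<mu> g) \<le> tv * C"
proof -
  have "cmod (cm_integral M \<mu> g) \<le> cmod (re.sintegral g) + cmod (im.sintegral g)"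
    unfolding cm_integral_eq by (rule order_trans[OF norm_triangle_ineq]) (simp add: norm_mult)
  also have "\<dots> \<le> tv * C"
    using re.sintegral_bound[OF assms] im.sintegral_bound[OF assms] by (simp add: tv_def distrib_right)
  finally show ?thesis .
qed

lemma cm_integral_tendsto:
  assumes "\<And>n::nat. bdd_measurable M (g n)" "bdd_measurable M f"
    and "\<And>n s. s \<in> space M \<Longrightarrow> cmod (g n s) \<le> C"
    and "\<And>s. s \<in> space M \<Longrightarrow> (\<lambda>n. g n s) \<longlonglongrightarrow> f s"
  shows "(\<lambda>n. cm_integral M \<mu> (g n)) \<longlonglongrightarrow> cm_integral M \<mu> f"
  unfolding cm_integral_eq
  by (intro tendsto_intros re.sintegral_tendsto[where C = C] im.sintegral_tendsto[where C = C] assms)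

lemma cm_integral_cong_null:
  assumes "bdd_measurable M g" "N \<in> sets M" "\<And>B. B \<in> sets M \<Longrightarrow> B \<subseteq> N \<Longrightarrow> \<mu> B = 0"
    and "f \<in> borel_measurable M" "\<And>s. s \<in> space M \<Longrightarrow> s \<notin> N \<Longrightarrow> f s = g s"
  shows "cm_integral M \<mu> f = cm_integral M \<mu> g"
  unfolding cm_integral_eq
  using re.sintegral_cong_null[of g N f] im.sintegral_cong_null[of g N f] assms by simp

lemma cm_integral_cong:
  assumes "\<And>s. s \<in> space M \<Longrightarrow> f s = g s"
  shows "cm_integral M \<mu> f = cm_integral M \<mu> g"
  unfolding cm_integral_def
  using assms by (intro arg_cong2[where f = "(+)"] arg_cong2[where f = "(*)"] arg_cong2[where f = "(-)"]
      Bochner_Integration.integral_cong refl)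
    (auto simp: signed_measure.space_positive_part[OF re.uminus] signed_measure.space_positive_part[OF im.uminus])

section \<open>Measures with a bounded density\<close>

text \<open>Countable additivity is dominated convergence for the indicators of the partial
  unions.\<close>

lemma cm_density_complex_measure:
  assumes "bdd_measurable M g"
  shows "complex_measure M (cm_density M g \<mu>)"
proof
  obtain C where C: "\<And>s. s \<in> space M \<Longrightarrow> cmod (g s) \<le> C"
    using assms unfolding bdd_measurable_def by blast
  have ind: "bdd_measurable M (\<lambda>s. indicator B s * g s)" if "B \<in> sets M" for B
    by (intro bdd_measurable_mult bdd_measurable_indicator that assms)
  have le: "cmod (indicator B s * g s) \<le> C" if "s \<in> space M" for B s
    using C[OF that] norm_ge_zero[of "g s"] by (auto simp: indicator_def simp del: norm_ge_zero)
  show "bounded_complex_measure M (cm_density M g \<mu>)"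
    unfolding bounded_complex_measure_def
  proof (intro conjI allI impI)
    show "\<exists>K. \<forall>B\<in>sets M. cmod (cm_density M g \<mu> B) \<le> K"
      unfolding cm_density_def using cm_integral_bound[OF ind le] by blast
    fix B :: "nat \<Rightarrow> 'b set"
    assume B: "range B \<subseteq> sets M" "disjoint_family B"
    have "(\<lambda>n. cm_integral M \<mu> (\<lambda>s. indicator (\<Union>i<n. B i) s * g s))
        \<longlonglongrightarrow> cm_integral M \<mu> (\<lambda>s. indicator (\<Union>i. B i) s * g s)"
    proof (rule cm_integral_tendsto[OF ind ind le])
      show "(\<lambda>n. indicator (\<Union>i<n. B i) s * g s) \<longlonglongrightarrow> indicator (\<Union>i. B i) s * g s" for s
        by (intro tendsto_mult tendsto_const LIMSEQ_indicator_UN)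
    qed (use B in auto)
    moreover have "cm_integral M \<mu> (\<lambda>s. indicator (\<Union>i<n. B i) s * g s)
        = (\<Sum>i<n. cm_integral M \<mu> (\<lambda>s. indicator (B i) s * g s))" for n
    proof -
      have "indicator (\<Union>i<n. B i) s * g s = (\<Sum>i<n. indicator (B i) s * g s)" for s
      proof -
        have "indicator (\<Union>i<n. B i) s = (\<Sum>i<n. indicator (B i) s :: complex)"
          using B(2) by (intro indicator_UN_disjoint) (auto simp: disjoint_family_on_def)
        then show ?thesis
          by (simp only: sum_distrib_right)
      qed
      then have "cm_integral M \<mu> (\<lambda>s. indicator (\<Union>i<n. B i) s * g s)
          = cm_integral M \<mu> (\<lambda>s. \<Sum>i<n. indicator (B i) s * g s)"
        by (rule cm_integral_cong)
      also have "\<dots> = (\<Sum>i<n. cm_integral M \<mu> (\<lambda>s. indicator (B i) s * g s))"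
        by (rule cm_integral_sum) (rule ind, use B in auto)
      finally show ?thesis .
    qed
    ultimately show "(\<lambda>i. cm_density M g \<mu> (B i)) sums cm_density M g \<mu> (\<Union>i. B i)"
      by (simp add: cm_density_def sums_def)
  qed
qed

text \<open>Both sides are continuous under bounded convergence and agree on indicator functions.\<close>

lemma cm_integral_density:
  assumes g: "bdd_measurable M g" and f: "bdd_measurable M f"
  shows "cm_integral M (cm_density M g \<mu>) f = cm_integral M \<mu> (\<lambda>s. f s * g s)"
proof -
  interpret d: complex_measure M "cm_density M g \<mu>"
    by (rule cm_density_complex_measure[OF g])
  obtain C where C: "\<And>s. s \<in> space M \<Longrightarrow> cmod (f s) \<le> C"
    using f unfolding bdd_measurable_def by blast
  obtain D where D: "\<And>s. s \<in> space M \<Longrightarrow> cmod (g s) \<le> D"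
    using g unfolding bdd_measurable_def by blast
  \<comment> \<open>The simple approximants are dominated by twice \<open>f\<close>, hence the
    constants \<open>2 * C\<close> and \<open>2 * C * D\<close> in the two limits below.\<close>
  obtain F where F: "\<And>i. simple_function M (F i)" "\<And>s. s \<in> space M \<Longrightarrow> (\<lambda>i. F i s) \<longlonglongrightarrow> f s"
    "\<And>i s. s \<in> space M \<Longrightarrow> cmod (F i s) \<le> 2 * cmod (f s)"
    using borel_measurable_implies_sequence_metric[of f M 0] f
    unfolding bdd_measurable_def dist_0_norm dist_complex_def diff_zero by metis
  have Fm: "bdd_measurable M (F i)" for i
  proof (rule bdd_measurableI)
    show "F i \<in> borel_measurable M"
      by (rule borel_measurable_simple_function[OF F(1)])
    show "cmod (F i s) \<le> 2 * C" if "s \<in> space M" for s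
      using F(3)[OF that, of i] C[OF that] by linarith
  qed
  have eq: "cm_integral M (cm_density M g \<mu>) (F i) = cm_integral M \<mu> (\<lambda>s. F i s * g s)" for i
  proof -
    have fin: "finite (F i ` space M)" and S: "\<And>y. F i -` {y} \<inter> space M \<in> sets M"
      using F(1)[of i] by (auto simp: simple_functionD)
    have ym: "bdd_measurable M (\<lambda>s. y * indicator (F i -` {y} \<inter> space M) s)" for y
      by (rule bdd_measurable_mult[OF bdd_measurable_const bdd_measurable_indicator[OF S]])
    have ymg: "bdd_measurable M (\<lambda>s. y * (indicator (F i -` {y} \<inter> space M) s * g s))" for y
      using bdd_measurable_mult[OF ym g] by (simp add: mult.assoc)
    \<comment> \<open>The canonical form of a simple function reduces the identity to indicators,
      where it is the definition of the density.\<close>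
    have F_eq: "F i s = (\<Sum>y\<in>F i ` space M. y * indicator (F i -` {y} \<inter> space M) s)" if "s \<in> space M" for s
      using that fin by (subst sum.remove[of _ "F i s"]) (auto simp: indicator_def intro!: sum.neutral)
    have "cm_integral M (cm_density M g \<mu>) (F i)
        = cm_integral M (cm_density M g \<mu>) (\<lambda>s. \<Sum>y\<in>F i ` space M. y * indicator (F i -` {y} \<inter> space M) s)"
      by (rule d.cm_integral_cong) (rule F_eq)
    also have "\<dots> = (\<Sum>y\<in>F i ` space M. y * cm_density M g \<mu> (F i -` {y} \<inter> space M))"
      using S by (subst d.cm_integral_sum)
(simp_all add: ym d.cm_integral_cmult d.cm_integral_indicator)
    also have "\<dots> = cm_integral M \<mu>
        (\<lambda>s. \<Sum>y\<in>F i ` space M. y * (indicator (F i -` {y} \<inter> space M) s * g s))"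
      using S g by (subst cm_integral_sum)
(simp_all add: ymg cm_integral_cmult cm_density_def)
    also have "\<dots> = cm_integral M \<mu> (\<lambda>s. F i s * g s)"
    proof (rule cm_integral_cong)
      fix s assume "s \<in> space M"
      from arg_cong[OF F_eq[OF this], of "\<lambda>x. x * g s"]
      show "(\<Sum>y\<in>F i ` space M. y * (indicator (F i -` {y} \<inter> space M) s * g s)) = F i s * g s"
        by (simp only: sum_distrib_right mult.assoc)
    qed
    finally show ?thesis .
  qed
  have "(\<lambda>i. cm_integral M (cm_density M g \<mu>) (F i)) \<longlonglongrightarrow> cm_integral M (cm_density M g \<mu>) f"
  proof (rule d.cm_integral_tendsto[OF Fm f])
    show "cmod (F i s) \<le> 2 * C" if "s \<in> space M" for i s
      using F(3)[OF that, of i] C[OF that] by linarith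
  qed (rule F(2))
  moreover have "(\<lambda>i. cm_integral M \<mu> (\<lambda>s. F i s * g s)) \<longlonglongrightarrow> cm_integral M \<mu> (\<lambda>s. f s * g s)"
  proof (rule cm_integral_tendsto)
    show "cmod (F i s * g s) \<le> 2 * C * D" if "s \<in> space M" for i s
      unfolding norm_mult using F(3)[OF that, of i] C[OF that] D[OF that]
      by (intro mult_mono) (auto intro: order_trans[OF norm_ge_zero])
    show "(\<lambda>i. F i s * g s) \<longlonglongrightarrow> f s * g s" if "s \<in> space M" for s
      by (intro tendsto_mult F(2) that tendsto_const)
  qed (intro bdd_measurable_mult Fm f g)+
  ultimately show ?thesis
    unfolding eq by (rule LIMSEQ_unique)
qed

end

subsection \<open>Hilbert spaces\<close>

lemma cinner_add_right: "cinner x (y + z) = cinner x y + cinner x (z :: 'a::chilbert_space)"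
  by (metis cinner_add_left cinner_commute complex_cnj_add)

lemma cinner_scaleC_right: "cinner x (a *\<^sub>C y) = cnj a * cinner x (y :: 'a::chilbert_space)"
  by (metis cinner_scaleC_left cinner_commute complex_cnj_mult)

lemma cinner_zero_left [simp]: "cinner 0 (y :: 'a::chilbert_space) = 0"
  using cinner_add_left[of 0 0 y] by simp

lemma cinner_zero_right [simp]: "cinner (x :: 'a::chilbert_space) 0 = 0"
  using cinner_add_right[of x 0 0] by simp

lemma cinner_scaleR_left: "cinner (r *\<^sub>R x) y = of_real r * cinner x (y :: 'a::chilbert_space)"
  by (metis cinner_scaleC_left scaleC_of_real)

lemma cinner_diff_left: "cinner (x - y) z = cinner x z - cinner y (z :: 'a::chilbert_space)"
  using cinner_add_left[of "x - y" y z] by simp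

lemma cinner_sum_left: "cinner (\<Sum>i\<in>S. f i) (y :: 'a::chilbert_space) = (\<Sum>i\<in>S. cinner (f i) y)"
  by (induction S rule: infinite_finite_induct) (auto simp: cinner_add_left)

lemma cinner_sum_right: "cinner (y :: 'a::chilbert_space) (\<Sum>i\<in>S. f i) = (\<Sum>i\<in>S. cinner y (f i))"
  by (induction S rule: infinite_finite_induct) (auto simp: cinner_add_right)

lemma cinner_self: "cinner x x = of_real ((norm (x :: 'a::chilbert_space))\<^sup>2)"
proof -
  have "Im (cinner x x) = 0"
    using arg_cong[OF cinner_commute[of x x], of Im] by simp
  then show ?thesis
    by (simp add: complex_eq_iff Re_cinner power2_norm_eq_inner)
qed

lemma cnj_mult_self: "cnj z * z = (complex_of_real (cmod z))\<^sup>2"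
  using complex_norm_square[of z] by (simp add: mult.commute)

text \<open>The axioms relate the norm to real scalars only; for complex ones the square of the norm
  is read off from \<open>cinner\<close>.\<close>

lemma norm_scaleC: "norm (a *\<^sub>C x) = cmod a * norm (x :: 'a::chilbert_space)"
proof -
  have "complex_of_real ((norm (a *\<^sub>C x))\<^sup>2) = of_real ((cmod a * norm x)\<^sup>2)"
    unfolding cinner_self[symmetric] cinner_scaleC_left cinner_scaleC_right
    by (simp add: cinner_self power_mult_distrib cnj_mult_self mult.left_commute[of a] flip: mult.assoc)
  then have "(norm (a *\<^sub>C x))\<^sup>2 = (cmod a * norm x)\<^sup>2"
    by (simp only: of_real_eq_iff)
  then show ?thesis
    by (simp add: power2_eq_iff_nonneg)
qed

text \<open>Multiplying \<open>x\<close> by the phase \<open>c\<close> makes the form real and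
  nonnegative, so the real Cauchy-Schwarz inequality applies. If the form vanishes then
  \<open>c = 0\<close>, hence only \<open>cmod c \<le> 1\<close> is available.\<close>

lemma cmod_cinner_le: "cmod (cinner x y) \<le> norm x * norm (y :: 'a::chilbert_space)"
proof -
  define c where "c = cnj (sgn (cinner x y))"
  have "cinner (c *\<^sub>C x) y = of_real (cmod (cinner x y))"
    unfolding cinner_scaleC_left c_def sgn_eq by (simp add: cnj_mult_self power2_eq_square)
  then have "cmod (cinner x y) = inner (c *\<^sub>C x) y"
    by (metis Re_cinner Re_complex_of_real)
  also have "\<dots> \<le> norm (c *\<^sub>C x) * norm y"
    by (rule norm_cauchy_schwarz)
  also have "\<dots> \<le> norm x * norm y"
    by (auto simp: norm_scaleC c_def norm_sgn intro!: mult_right_mono mult_left_le_one_le)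
  finally show ?thesis .
qed

lemma bounded_linear_cinner_left: "bounded_linear (\<lambda>x. cinner x (y :: 'a::chilbert_space))"
  by (rule bounded_linear_intro[where K = "norm y"])
    (auto simp: cinner_add_left cinner_scaleR_left scaleR_conv_of_real cmod_cinner_le)

section \<open>Representing vectors and adjoints\<close>

lemma cinner_eqI:
  assumes "\<And>z. cinner x z = cinner (y :: 'a::chilbert_space) z"
  shows "x = y"
proof -
  have "cinner (x - y) (x - y) = 0"
    using assms by (simp add: cinner_diff_left)
  then show ?thesis
    by (simp add: cinner_self)
qed

text \<open>The representing vector minimises \<open>\<parallel>y\<parallel>\<^sup>2 - 2 f y\<close>; a minimising sequence is Cauchy
  by the parallelogram law.\<close>

lemma riesz_representation_real:
  fixes f :: "'a::{real_inner, complete_space} \<Rightarrow> real"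
  assumes f: "bounded_linear f"
  shows "\<exists>y. \<forall>x. f x = inner x y"
proof -
  interpret f: bounded_linear f by fact
  obtain K where K: "\<And>x. \<bar>f x\<bar> \<le> norm x * K"
    using f.bounded by auto
  define J where "J y = (norm y)\<^sup>2 - 2 * f y" for y
  define m where "m = Inf (range J)"
  have "- K\<^sup>2 \<le> J y" for y
  proof -
    have "0 \<le> (norm y - K)\<^sup>2"
      by simp
    then show ?thesis
      using K[of y] by (simp add: J_def power2_diff mult.commute)
  qed
  then have bdd: "bdd_below (range J)"
    by (intro bdd_belowI[of _ "- K\<^sup>2"]) auto
  have m_le: "m \<le> J y" for y
    unfolding m_def by (rule cInf_lower[OF _ bdd]) simp
  have "\<exists>y. J y < m + 1 / real (Suc n)" for n
    using cInf_lessD[of "range J" "m + 1 / real (Suc n)"] unfolding m_def by auto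
  then obtain y where y: "\<And>n. J (y n) < m + 1 / real (Suc n)"
    by metis
  \<comment> \<open>The linear terms of \<open>J\<close> cancel here. As \<open>m\<close> bounds
    \<open>J\<close> at the midpoint from below, two near-minimisers must be close to each
    other.\<close>
  have par: "(norm (u - v))\<^sup>2 = 2 * J u + 2 * J v - 4 * J ((1/2) *\<^sub>R (u + v))" for u v
    by (simp add: J_def f.scaleR f.add power_divide power2_norm_eq_inner algebra_simps inner_commute)
  have "Cauchy y"
  proof (rule metric_CauchyI)
    fix e :: real assume "0 < e"
    then obtain N where N: "1 / real (Suc N) < e\<^sup>2 / 4"
      using reals_Archimedean[of "e\<^sup>2 / 4"] by (auto simp: inverse_eq_divide)
    show "\<exists>N. \<forall>p\<ge>N. \<forall>q\<ge>N. dist (y p) (y q) < e"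
    proof (intro exI allI impI)
      fix p q assume "N \<le> p" "N \<le> q"
      then have "1 / real (Suc p) \<le> 1 / real (Suc N)" "1 / real (Suc q) \<le> 1 / real (Suc N)"
        by (auto intro!: divide_left_mono)
      then have "(norm (y p - y q))\<^sup>2 < e\<^sup>2"
        using par[of "y p" "y q"] y[of p] y[of q] m_le[of "(1/2) *\<^sub>R (y p + y q)"] N by linarith
      then show "dist (y p) (y q) < e"
        using \<open>0 < e\<close> by (simp add: dist_norm power_less_imp_less_base)
    qed
  qed
  then obtain z where z: "y \<longlonglongrightarrow> z"
    using Cauchy_convergent convergent_def by blast
  have "(\<lambda>n. J (y n)) \<longlonglongrightarrow> J z"
    unfolding J_def by (intro tendsto_intros z f.tendsto)
  moreover have "(\<lambda>n. m + 1 / real (Suc n)) \<longlonglongrightarrow> m + 0"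
    using LIMSEQ_inverse_real_of_nat by (intro tendsto_add tendsto_const) (simp add: inverse_eq_divide)
  ultimately have "J z \<le> m + 0"
    using y by (intro LIMSEQ_le[of "\<lambda>n. J (y n)"]) (auto intro: less_imp_le)
  then have min: "J z \<le> J w" for w
    using m_le[of w] by linarith
  have "f x = inner x z" for x
  proof (cases "x = 0")
    case False
    define d where "d = f x - inner x z"
    \<comment> \<open>The minimiser of the quadratic polynomial \<open>J (z + t *\<^sub>R x)\<close>
      in \<open>t\<close>.\<close>
    define t where "t = d / (norm x)\<^sup>2"
    have "J (z + t *\<^sub>R x) = J z + t\<^sup>2 * (norm x)\<^sup>2 - 2 * t * d"
      unfolding J_def d_def power2_norm_eq_inner
      by (simp add: f.add f.scaleR inner_add_left inner_add_right inner_commute algebra_simps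
          power2_eq_square)
    also have "t\<^sup>2 * (norm x)\<^sup>2 = t * d"
      using False by (simp add: t_def power2_eq_square)
    finally have "J (z + t *\<^sub>R x) = J z - t * d"
      by simp
    then have "t * d \<le> 0"
      using min[of "z + t *\<^sub>R x"] by simp
    then have "d\<^sup>2 \<le> 0"
      using False by (auto simp: t_def power2_eq_square divide_le_0_iff mult_le_0_iff)
    then show ?thesis
      by (simp add: d_def)
  qed (simp add: f.zero)
  then show ?thesis
    by blast
qed

text \<open>The real theorem represents the real part of \<open>f\<close>; the imaginary part is
  recovered by evaluating at \<open>\<i> *\<^sub>C x\<close>.\<close>

lemma riesz_representation:
  fixes f :: "'a::chilbert_space \<Rightarrow> complex"
  assumes add: "\<And>x y. f (x + y) = f x + f y" and scale: "\<And>a x. f (a *\<^sub>C x) = a * f x"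
    and bound: "\<And>x. cmod (f x) \<le> K * norm x"
  shows "\<exists>y. \<forall>x. f x = cinner x y"
proof -
  have "bounded_linear (\<lambda>x. Re (f x))"
  proof (rule bounded_linear_intro)
    show "Re (f (r *\<^sub>R x)) = r *\<^sub>R Re (f x)" for r x
      using scale[of "of_real r" x] by (simp add: scaleC_of_real)
    show "norm (Re (f x)) \<le> norm x * K" for x
      using bound[of x] abs_Re_le_cmod[of "f x"] by (simp add: mult.commute)
  qed (simp add: add)
  from riesz_representation_real[OF this] obtain y where y: "\<And>x. Re (f x) = inner x y"
    by blast
  have "Im (f x) = Im (cinner x y)" for x
    using y[of "\<i> *\<^sub>C x"] by (simp add: scale Re_cinner[symmetric] cinner_scaleC_left)
  then show ?thesis
    using y by (auto simp: complex_eq_iff Re_cinner)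
qed

text \<open>Produces the adjoint image of the single vector \<open>y\<close>; its norm is bounded by
  testing the identity at \<open>x = v\<close>.\<close>

lemma adjoint_exists:
  fixes B :: "'a::chilbert_space \<Rightarrow> 'a"
  assumes "bounded_linear B" "\<And>a x. B (a *\<^sub>C x) = a *\<^sub>C B x" and "\<And>x. norm (B x) \<le> C * norm x" "0 \<le> C"
  shows "\<exists>v. (\<forall>x. cinner (B x) y = cinner x v) \<and> norm v \<le> C * norm y"
proof -
  have bd: "cmod (cinner (B x) y) \<le> C * norm x * norm y" for x
    by (rule order_trans[OF cmod_cinner_le mult_right_mono]) (use assms in auto)
  obtain v where v: "\<And>x. cinner (B x) y = cinner x v"
    using riesz_representation[of "\<lambda>x. cinner (B x) y" "C * norm y"] assms(2) bd
    by (auto simp: bounded_linear.linear[OF assms(1)] linear_add cinner_add_left cinner_scaleC_left mult_ac)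
  have "norm v * norm v \<le> (C * norm y) * norm v"
    using bd[of v] unfolding v cinner_self norm_of_real by (simp add: power2_eq_square mult_ac)
  then have "norm v \<le> C * norm y"
    using assms(4) by (cases "v = 0") auto
  with v show ?thesis
    by blast
qed

subsection \<open>Finite Fourier transform\<close>

text \<open>A geometric sum of \<open>P\<close>-th roots of unity. The shift \<open>l\<close> only
  contributes a constant phase, and \<open>\<bar>d\<bar> < P\<close> leaves \<open>d = 0\<close> as
  the only multiple of \<open>P\<close>.\<close>

lemma sum_roots_of_unity:
  fixes d :: int
  assumes "\<bar>d\<bar> < int P"
  shows "(\<Sum>k<P. cis (2 * pi * (real k - l) * real_of_int d / real P)) = (if d = 0 then of_nat P else 0)"
proof (cases "d = 0")
  case False
  have P: "0 < P"
    using assms by linarith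
  define z where "z = cis (2 * pi * real_of_int d / real P)"
  have "z \<noteq> 1"
  proof
    assume "z = 1"
    then have "cos (2 * pi * real_of_int d / real P) = 1"
      by (simp add: z_def complex_eq_iff)
    then obtain n :: int where "2 * pi * real_of_int d / real P = real_of_int n * 2 * pi"
      by (auto simp: cos_one_2pi_int)
    then have "real_of_int d = real_of_int (n * int P)"
      using P by (simp add: field_simps)
    then have "d = n * int P"
      by linarith
    with False assms show False
      by (simp add: abs_mult)
  qed
  moreover have "z ^ P = 1"
    using P unfolding z_def Complex.DeMoivre
    by simp
  ultimately have "(\<Sum>k<P. z ^ k) = 0"
    by (simp add: geometric_sum)
  moreover have "cis (2 * pi * (real k - l) * real_of_int d / real P)
      = cis (- 2 * pi * l * real_of_int d / real P) * z ^ k" for k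
    unfolding z_def Complex.DeMoivre cis_mult
    by (rule arg_cong[of _ _ cis]) (simp add: algebra_simps add_divide_distrib diff_divide_distrib)
  ultimately show ?thesis
    using False by (simp add: sum_distrib_left[symmetric])
qed simp

text \<open>Expanding the squares leaves the diagonal by orthogonality, because differences of
  indices below \<open>n \<le> P\<close> stay below \<open>P\<close>. The sign
  \<open>\<sigma>\<close> allows both orientations of the transform, and \<open>l\<close> any shift
  of the frequencies.\<close>

lemma parseval:
  fixes u :: "nat \<Rightarrow> 'a::chilbert_space"
    and \<sigma> :: int
  assumes "n \<le> P" "\<bar>\<sigma>\<bar> = 1"
  shows "(\<Sum>k<P. (norm (\<Sum>i<n. cis (2 * pi * (real k - l) * (\<sigma> * real i) / real P) *\<^sub>C u i))\<^sup>2)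
    = real P * (\<Sum>i<n. (norm (u i))\<^sup>2)"
proof -
  define e where "e k i = cis (2 * pi * (real k - l) * (\<sigma> * real i) / real P)" for k i
  have e: "e k i * cnj (e k j) = cis (2 * pi * (real k - l) * real_of_int (\<sigma> * (int i - int j)) / real P)" for k i j
    unfolding e_def cis_cnj cis_mult
    by (rule arg_cong[of _ _ cis]) (simp add: algebra_simps add_divide_distrib diff_divide_distrib)
  have "complex_of_real (\<Sum>k<P. (norm (\<Sum>i<n. e k i *\<^sub>C u i))\<^sup>2)
      = (\<Sum>k<P. \<Sum>i<n. \<Sum>j<n. e k i * cnj (e k j) * cinner (u i) (u j))"
    unfolding of_real_sum cinner_self[symmetric] cinner_sum_left cinner_scaleC_left
    by (simp add: cinner_sum_right cinner_scaleC_right sum_distrib_left mult.assoc)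
  also have "\<dots> = (\<Sum>i<n. \<Sum>j<n. (\<Sum>k<P. e k i * cnj (e k j)) * cinner (u i) (u j))"
    unfolding sum_distrib_right by (subst sum.swap, subst sum.swap) (rule refl)
  also have "\<dots> = (\<Sum>i<n. \<Sum>j<n. if i = j then of_nat P * cinner (u i) (u i) else 0)"
  proof (intro sum.cong refl)
    fix i j assume "i \<in> {..<n}" "j \<in> {..<n}"
    then have "\<bar>\<sigma> * (int i - int j)\<bar> < int P"
      using assms by (auto simp: abs_mult)
    then show "(\<Sum>k<P. e k i * cnj (e k j)) * cinner (u i) (u j)
        = (if i = j then of_nat P * cinner (u i) (u i) else 0)"
      unfolding e using assms(2) by (subst sum_roots_of_unity) auto
  qed
  also have "\<dots> = (\<Sum>i<n. of_nat P * cinner (u i) (u i))"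
    by simp
  also have "\<dots> = complex_of_real (real P * (\<Sum>i<n. (norm (u i))\<^sup>2))"
    by (simp add: cinner_self sum_distrib_left)
  finally show ?thesis
    unfolding e_def by (simp only: of_real_eq_iff)
qed

text \<open>Cauchy-Schwarz is used twice: in the Hilbert space for each \<open>k\<close>, then for
  the finite sum over \<open>k\<close>.\<close>

lemma sum_cmod_cinner_le:
  fixes a b :: "nat \<Rightarrow> 'a::chilbert_space"
  assumes "(\<Sum>k<P. (norm (a k))\<^sup>2) \<le> A\<^sup>2" "(\<Sum>k<P. (norm (b k))\<^sup>2) \<le> B\<^sup>2" "0 \<le> A" "0 \<le> B"
  shows "(\<Sum>k<P. cmod (cinner (a k) (b k))) \<le> A * B"
proof -
  have "(\<Sum>k<P. cmod (cinner (a k) (b k))) \<le> (\<Sum>k<P. \<bar>norm (a k)\<bar> * \<bar>norm (b k)\<bar>)"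
    by (intro sum_mono) (simp add: cmod_cinner_le)
  also have "\<dots> \<le> L2_set (\<lambda>k. norm (a k)) {..<P} * L2_set (\<lambda>k. norm (b k)) {..<P}"
    by (rule L2_set_mult_ineq)
  also have "\<dots> \<le> A * B"
    using assms by (intro mult_mono) (auto simp: L2_set_def intro!: real_le_lsqrt sum_nonneg)
  finally show ?thesis .
qed

subsection \<open>Sampled Fejer means\<close>

text \<open>The Fejer kernel of period 1, normalised to have integral 1 over a period.\<close>

definition fejer :: "nat \<Rightarrow> real \<Rightarrow> real"
  where "fejer N t = (cmod (\<Sum>k<N. cis (2 * pi * real k * t)))\<^sup>2 / real N"

lemma fejer_nonneg: "0 \<le> fejer N t"
  by (simp add: fejer_def)

lemma fejer_expand:
  "complex_of_real (fejer N t) = (\<Sum>k<N. \<Sum>l<N. cis (2 * pi * (real k - real l) * t)) / of_nat N"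
proof -
  have "cis (2 * pi * real k * t) * cnj (cis (2 * pi * real l * t)) = cis (2 * pi * (real k - real l) * t)"
    for k l
    unfolding cis_cnj cis_mult by (rule arg_cong[of _ _ cis]) (simp add: algebra_simps)
  then show ?thesis
    unfolding fejer_def of_real_divide complex_norm_square cnj_sum sum_product by simp
qed

text \<open>Sampling at \<open>5 * N\<close> points is exact: all frequencies
  \<open>k - l + r\<close> have absolute value below \<open>5 * N\<close>, so there is no aliasing.
  Exactly \<open>N - r\<close> pairs satisfy \<open>l = k + r\<close>.\<close>

lemma fejer_sum:
  assumes "0 < N" "r \<le> N"
  shows "(\<Sum>j<5 * N. complex_of_real (fejer N (\<tau> - real j / real (5 * N)))
      * cis (2 * pi * real r * (\<tau> - real j / real (5 * N)))) = of_nat (5 * (N - r))"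
proof -
  let ?P = "5 * N"
  define t where "t j = \<tau> - real j / real ?P" for j
  have inner_sum: "(\<Sum>j<?P. cis (2 * pi * (real k - real l) * t j) * cis (2 * pi * real r * t j))
      = (if l = k + r then of_nat ?P else 0)" if "k < N" "l < N" for k l
  proof -
    define d where "d = int l - int k - int r"
    have "cis (2 * pi * (real k - real l) * t j) * cis (2 * pi * real r * t j)
        = cis (- 2 * pi * real_of_int d * \<tau>) * cis (2 * pi * (real j - 0) * real_of_int d / real ?P)" for j
      unfolding cis_mult
      by (rule arg_cong[of _ _ cis]) (use assms in \<open>simp add: t_def d_def field_simps\<close>)
    then have "(\<Sum>j<?P. cis (2 * pi * (real k - real l) * t j) * cis (2 * pi * real r * t j))
        = cis (- 2 * pi * real_of_int d * \<tau>) * (if d = 0 then of_nat ?P else 0)"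
      using that assms by (simp only: sum_distrib_left[symmetric], subst sum_roots_of_unity) (auto simp: d_def)
    then show ?thesis
      by (auto simp: d_def)
  qed
  have "(\<Sum>j<?P. complex_of_real (fejer N (t j)) * cis (2 * pi * real r * t j))
      = (\<Sum>k<N. \<Sum>l<N. \<Sum>j<?P. cis (2 * pi * (real k - real l) * t j) * cis (2 * pi * real r * t j)) / of_nat N"
    unfolding fejer_expand sum_distrib_right times_divide_eq_left sum_divide_distrib[symmetric]
    by (subst sum.swap, subst (2) sum.swap) (rule refl)
  also have "(\<Sum>k<N. \<Sum>l<N. \<Sum>j<?P. cis (2 * pi * (real k - real l) * t j) * cis (2 * pi * real r * t j))
      = (\<Sum>k<N. if k \<in> {..<N - r} then complex_of_nat ?P else 0)"
    by (intro sum.cong refl) (auto simp: inner_sum sum.delta)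
  also have "\<dots> = (\<Sum>k\<in>{..<N} \<inter> {..<N - r}. complex_of_nat ?P)"
    by (rule sum.inter_restrict[symmetric]) simp
  also have "{..<N} \<inter> {..<N - r} = {..<N - r}"
    by auto
  finally show ?thesis
    using assms by (simp add: t_def)
qed

text \<open>The cases \<open>r = 0\<close> and \<open>r = 1\<close>: the total mass, and the cosine
  moment that measures how concentrated the kernel is.\<close>

lemma fejer_sum_eq:
  assumes "0 < N"
  shows "(\<Sum>j<5 * N. fejer N (\<tau> - real j / real (5 * N))) = real (5 * N)"
    and "(\<Sum>j<5 * N. fejer N (\<tau> - real j / real (5 * N)) * cos (2 * pi * (\<tau> - real j / real (5 * N))))
      = real (5 * N) - 5"
proof -
  have "complex_of_real (\<Sum>j<5 * N. fejer N (\<tau> - real j / real (5 * N))) = of_real (real (5 * N))"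
    using fejer_sum[OF assms, of 0 \<tau>] by simp
  then show "(\<Sum>j<5 * N. fejer N (\<tau> - real j / real (5 * N))) = real (5 * N)"
    by (simp only: of_real_eq_iff)
  show "(\<Sum>j<5 * N. fejer N (\<tau> - real j / real (5 * N)) * cos (2 * pi * (\<tau> - real j / real (5 * N))))
      = real (5 * N) - 5"
    using arg_cong[OF fejer_sum[OF assms, of 1 \<tau>], of Re] assms by (simp add: of_nat_diff)
qed

lemma one_minus_cos_bounded_below:
  assumes "0 < \<delta>" "b < 2 * pi"
  shows "\<exists>\<kappa>>0. \<forall>x. \<delta> \<le> \<bar>x\<bar> \<longrightarrow> \<bar>x\<bar> \<le> b \<longrightarrow> \<kappa> \<le> 1 - cos x"
proof (cases "\<delta> \<le> b")
  case True
  have "\<exists>x\<in>{\<delta>..b}. \<forall>y\<in>{\<delta>..b}. 1 - cos x \<le> 1 - cos y"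
    using True by (intro continuous_attains_inf continuous_intros) auto
  then obtain x where x: "x \<in> {\<delta>..b}" "\<And>y. y \<in> {\<delta>..b} \<Longrightarrow> 1 - cos x \<le> 1 - cos y"
    by blast
  \<comment> \<open>\<open>1 - cos x\<close> is twice the square of
    \<open>sin (x / 2)\<close>.\<close>
  have "0 < sin (x / 2)"
    using x(1) assms by (intro sin_gt_zero) auto
  then have "0 < 1 - cos x"
    using cos_double_sin[of "x / 2"] by simp
  moreover have "1 - cos x \<le> 1 - cos y" if "\<delta> \<le> \<bar>y\<bar>" "\<bar>y\<bar> \<le> b" for y
    using x(2)[of "\<bar>y\<bar>"] that by simp
  ultimately show ?thesis
    by blast
next
  case False
  \<comment> \<open>No \<open>x\<close> satisfies both bounds, so any positive value will
    do.\<close>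
  then show ?thesis
    by (intro exI[of _ 1]) auto
qed

text \<open>Terms are grouped by \<open>j = i + q\<close>; the cardinality is the discrete
  convolution of two indicators. The last index \<open>j = m + N - 1\<close> has count 0 and is kept
  so that \<open>m = 4 * N\<close> gives all \<open>5 * N\<close> points of a period.\<close>

lemma sum_diagonals:
  fixes f :: "nat \<Rightarrow> complex"
  shows "(\<Sum>q<N. \<Sum>i<m. f (i + q)) = (\<Sum>j<m + N. of_nat (card {q. q < N \<and> q \<le> j \<and> j < q + m}) * f j)"
proof -
  have "(\<Sum>i<m. f (i + q)) = (\<Sum>j<m + N. if q \<le> j \<and> j < q + m then f j else 0)" if "q < N" for q
  proof -
    have "(\<Sum>i<m. f (i + q)) = (\<Sum>j\<in>{j\<in>{..<m + N}. q \<le> j \<and> j < q + m}. f j)"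
      by (rule sum.reindex_bij_witness[of _ "\<lambda>j. j - q" "\<lambda>i. i + q"]) (use that in auto)
    also have "\<dots> = (\<Sum>j<m + N. if q \<le> j \<and> j < q + m then f j else 0)"
      by (rule sum.inter_filter) simp
    finally show ?thesis .
  qed
  then have "(\<Sum>q<N. \<Sum>i<m. f (i + q)) = (\<Sum>q<N. \<Sum>j<m + N. if q \<le> j \<and> j < q + m then f j else 0)"
    by simp
  also have "\<dots> = (\<Sum>j<m + N. \<Sum>q<N. if q \<le> j \<and> j < q + m then f j else 0)"
    by (rule sum.swap)
  also have "\<dots> = (\<Sum>j<m + N. \<Sum>q\<in>{q\<in>{..<N}. q \<le> j \<and> j < q + m}. f j)"
    by (intro sum.cong refl sum.inter_filter[symmetric]) simp
  also have "\<dots> = (\<Sum>j<m + N. of_nat (card {q. q < N \<and> q \<le> j \<and> j < q + m}) * f j)"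
    by simp
  finally show ?thesis .
qed

text \<open>The weights \<open>n j / N\<close> sample the trapezoid that is \<open>1\<close> on \<open>[1, 4]\<close> and supported in \<open>[0, 5]\<close>.\<close>

lemma diagonal_count:
  fixes y :: real
  assumes "0 < N" "j < 5 * N" "1 \<le> y" "y \<le> 4"
  defines "n \<equiv> card {q. q < N \<and> q \<le> j \<and> j < q + 4 * N}"
  shows "n \<le> N" "real N - real n \<le> \<bar>real j - y * real N\<bar> + 1"
proof -
  have fin: "finite {q. q < N \<and> q \<le> j \<and> j < q + 4 * N}"
    by (rule finite_subset[of _ "{..<N}"]) auto
  show "n \<le> N"
    unfolding n_def using card_mono[of "{..<N}" "{q. q < N \<and> q \<le> j \<and> j < q + 4 * N}"] by auto
  have yN: "real N \<le> y * real N" "y * real N \<le> 4 * real N"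
    using assms by (auto simp: mult_right_mono)
  consider "j < N" | "N \<le> j" "j < 4 * N" | "4 * N \<le> j"
    by linarith
  then show "real N - real n \<le> \<bar>real j - y * real N\<bar> + 1"
  proof cases
    case 1
    have "card {..j} \<le> n"
      unfolding n_def by (rule card_mono[OF fin]) (use 1 in auto)
    then show ?thesis
      using yN by simp
  next
    case 2
    have "card {..<N} \<le> n"
      unfolding n_def by (rule card_mono[OF fin]) (use 2 in auto)
    then show ?thesis
      by simp
  next
    \<comment> \<open>On the falling flank \<open>q\<close> starts at \<open>j + 1 - 4 * N\<close>,
      which leaves \<open>5 * N - j - 1\<close> values; the \<open>+ 1\<close> in the bound comes
      from here.\<close>
    case 3
    have "card {j + 1 - 4 * N..<N} \<le> n"
      unfolding n_def by (rule card_mono[OF fin]) (use 3 in auto)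
    then have "5 * N \<le> n + j + 1"
      using 3 assms(2) by simp
    then have "5 * real N \<le> real n + real j + 1"
      by linarith
    then show ?thesis
      using yN by linarith
  qed
qed

text \<open>Grid points near \<open>s\<close> are handled by uniform continuity and by the trapezoid
  being close to 1 there. The weight of the far points is controlled as in Chebyshev's inequality,
  by the average of \<open>1 - cos\<close>, which is \<open>1 / N\<close>. The sum is kept in the
  indices \<open>i\<close> and \<open>q\<close> because the semigroup law factorises it in that
  form.\<close>

lemma sampled_fejer_approximation:
  fixes g :: "real \<Rightarrow> complex"
  assumes a: "0 < a" and cont: "continuous_on {0..5 * a} g" and e: "0 < \<epsilon>"
  shows "\<exists>N>0. \<forall>s\<in>{a..4 * a}.
    cmod (g s - (\<Sum>q<N. \<Sum>i<4 * N. g (real (i + q) * a / real N)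
      * of_real (fejer N (s / (5 * a) - real (i + q) / real (5 * N)) / real (5 * N * N)))) \<le> \<epsilon>"
proof -
  have "bounded (g ` {0..5 * a})"
    by (intro compact_imp_bounded compact_continuous_image cont) simp
  then obtain G where G: "0 < G" "\<And>s. s \<in> {0..5 * a} \<Longrightarrow> cmod (g s) \<le> G"
    unfolding bounded_pos by auto
  have "uniformly_continuous_on {0..5 * a} g"
    by (rule compact_uniformly_continuous[OF cont]) simp
  moreover have "0 < \<epsilon> / 4"
    using e by simp
  ultimately obtain \<delta>' where \<delta>': "0 < \<delta>'"
    and *: "\<forall>s\<in>{0..5 * a}. \<forall>t\<in>{0..5 * a}. dist t s < \<delta>' \<longrightarrow> dist (g t) (g s) < \<epsilon> / 4"
    unfolding uniformly_continuous_on_def by blast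
  have g_close: "cmod (g t - g s) < \<epsilon> / 4" if "s \<in> {0..5 * a}" "t \<in> {0..5 * a}" "\<bar>t - s\<bar> < \<delta>'" for s t
    using * that by (simp add: dist_norm)
  \<comment> \<open>The second bound keeps the trapezoid, whose slope is at most
    \<open>1 / a\<close>, within \<open>\<epsilon> / (4 * G)\<close> of 1, up to rounding.\<close>
  define \<delta> where "\<delta> = min \<delta>' (a * \<epsilon> / (4 * G))"
  have \<delta>: "0 < \<delta>" "\<delta> \<le> \<delta>'" "\<delta> \<le> a * \<epsilon> / (4 * G)"
    using \<delta>' a e G by (auto simp: \<delta>_def)
  \<comment> \<open>Points of \<open>[a, 4a]\<close> and \<open>[0, 5a]\<close> are at most
    \<open>4a\<close> apart, less than the period \<open>5a\<close>: the angle stays below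
    \<open>8 * pi / 5\<close> and cannot wrap around to 0.\<close>
  obtain \<kappa> where \<kappa>: "0 < \<kappa>" "\<And>x. 2 * pi * \<delta> / (5 * a) \<le> \<bar>x\<bar> \<Longrightarrow> \<bar>x\<bar> \<le> 8 * pi / 5 \<Longrightarrow> \<kappa> \<le> 1 - cos x"
    using one_minus_cos_bounded_below[of "2 * pi * \<delta> / (5 * a)" "8 * pi / 5"] \<delta>(1) a by auto
  \<comment> \<open>The first summand makes the rounding error \<open>G / N\<close> small, the
    second the contribution \<open>2 * G / \<kappa> / N\<close> of the far points.\<close>
  obtain N0 :: nat where N0: "4 * G / \<epsilon> + 8 * G / (\<kappa> * \<epsilon>) < real N0"
    using reals_Archimedean2 by blast
  define N where "N = Suc N0"
  have N: "0 < N" "4 * G / \<epsilon> + 8 * G / (\<kappa> * \<epsilon>) \<le> real N"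
    using N0 by (auto simp: N_def)
  have "0 \<le> 4 * G / \<epsilon>" "0 \<le> 8 * G / (\<kappa> * \<epsilon>)"
    using G e \<kappa> by auto
  then have "4 * G / \<epsilon> \<le> real N" "8 * G / (\<kappa> * \<epsilon>) \<le> real N"
    using N by linarith+
  then have N1: "G / real N \<le> \<epsilon> / 4" and N2: "2 * G / \<kappa> / real N \<le> \<epsilon> / 4"
    using N(1) e \<kappa>(1) by (simp_all add: field_simps)
  define n where "n j = card {q. q < N \<and> q \<le> j \<and> j < q + 4 * N}" for j
  show ?thesis
  proof (intro exI[of _ N] conjI ballI)
    fix s assume s: "s \<in> {a..4 * a}"
    define t where "t j = s / (5 * a) - real j / real (5 * N)" for j
    define z where "z j = real j * a / real N" for j
    define w where "w j = fejer N (t j) / real (5 * N)" for j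
    have w_nonneg: "0 \<le> w j" for j
      by (simp add: w_def fejer_nonneg)
    have w_sum: "(\<Sum>j<5 * N. w j) = 1"
      using fejer_sum_eq(1)[OF N(1), of "s / (5 * a)"] N(1)
      by (simp add: w_def t_def sum_divide_distrib[symmetric])
    have "(\<Sum>j<5 * N. w j * cos (2 * pi * t j)) = 1 - 1 / real N"
      using fejer_sum_eq(2)[OF N(1), of "s / (5 * a)"] N(1)
      by (simp add: w_def t_def sum_divide_distrib[symmetric] diff_divide_distrib)
    then have w_cos: "(\<Sum>j<5 * N. w j * (1 - cos (2 * pi * t j))) = 1 / real N"
      using w_sum by (simp add: right_diff_distrib sum_subtractf)
    \<comment> \<open>The three quarters of \<open>\<epsilon>\<close> pay for continuity, the slope
      of the trapezoid and the rounding in \<open>n j\<close>; the cosine term pays for the far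
      points and averages to at most the last quarter.\<close>
    have err: "cmod (g s - of_real (real (n j) / real N) * g (z j))
        \<le> 3 * \<epsilon> / 4 + 2 * G / \<kappa> * (1 - cos (2 * pi * t j))" if j: "j < 5 * N" for j
    proof -
      have n_le: "n j \<le> N" and n_ge: "real N - real (n j) \<le> \<bar>real j - s / a * real N\<bar> + 1"
        unfolding n_def
        by (rule diagonal_count[where y = "s / a"]; use N(1) j s a in \<open>simp add: field_simps\<close>)+
      have z_mem: "z j \<in> {0..5 * a}"
      proof -
        have "real j * a \<le> real (5 * N) * a"
          using j a by (intro mult_right_mono) auto
        then show ?thesis
          using N(1) a by (simp add: z_def field_simps)
      qed
      have s_mem: "s \<in> {0..5 * a}"
        using s a by auto
      define \<theta> where "\<theta> = real (n j) / real N"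
      have \<theta>: "0 \<le> \<theta>" "\<theta> \<le> 1"
        using n_le N(1) by (auto simp: \<theta>_def)
      have cos_term: "0 \<le> 2 * G / \<kappa> * (1 - cos (2 * pi * t j))"
        using G \<kappa> by simp
      have tz: "2 * pi * t j = 2 * pi / (5 * a) * (s - z j)"
        using a N(1) by (simp add: t_def z_def field_simps)
      show ?thesis
      proof (cases "\<bar>z j - s\<bar> < \<delta>")
        case True
        have "1 - \<theta> \<le> \<bar>z j - s\<bar> / a + 1 / real N"
        proof -
          have "\<bar>real j - s / a * real N\<bar> = \<bar>real N / a * (z j - s)\<bar>"
            by (rule arg_cong[of _ _ abs]) (use a N(1) in \<open>simp add: z_def field_simps\<close>)
          also have "\<dots> = real N / a * \<bar>z j - s\<bar>"
            using a by (simp add: abs_mult)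
          finally have "(real N - real (n j)) / real N \<le> (real N / a * \<bar>z j - s\<bar> + 1) / real N"
            using n_ge by (intro divide_right_mono) auto
          then show ?thesis
            using N(1) by (simp add: \<theta>_def add_divide_distrib diff_divide_distrib)
        qed
        also have "\<dots> \<le> \<delta> / a + 1 / real N"
          using True a by (simp add: divide_right_mono)
        finally have "(1 - \<theta>) * G \<le> (\<delta> / a + 1 / real N) * G"
          using G(1) by (intro mult_right_mono) auto
        also have "\<dots> = \<delta> / a * G + G / real N"
          by (simp add: distrib_right)
        also have "\<delta> / a * G \<le> (a * \<epsilon> / (4 * G)) / a * G"
          using \<delta>(3) a G(1) by (intro mult_right_mono divide_right_mono) auto
        also have "\<dots> = \<epsilon> / 4"
          using a G(1) by simp
        finally have \<theta>G: "(1 - \<theta>) * G \<le> \<epsilon> / 2"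
          using N1 by linarith
        have eq: "g s - of_real \<theta> * g (z j) = (g s - g (z j)) + of_real (1 - \<theta>) * g (z j)"
          by (simp add: algebra_simps)
        have "cmod (g s - of_real \<theta> * g (z j)) \<le> cmod (g s - g (z j)) + (1 - \<theta>) * cmod (g (z j))"
          unfolding eq using \<theta> norm_triangle_ineq[of "g s - g (z j)" "of_real (1 - \<theta>) * g (z j)"]
          by (simp add: norm_mult del: of_real_diff)
        also have "(1 - \<theta>) * cmod (g (z j)) \<le> (1 - \<theta>) * G"
          using G(2)[OF z_mem] \<theta> by (intro mult_left_mono) auto
        also have "cmod (g s - g (z j)) < \<epsilon> / 4"
          using True \<delta>(2) by (intro g_close z_mem s_mem) auto
        finally show ?thesis
          using \<theta>G cos_term unfolding \<theta>_def by linarith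
      next
        case False
        have "2 * pi / (5 * a) * \<delta> \<le> 2 * pi / (5 * a) * \<bar>s - z j\<bar>"
          using False a by (intro mult_left_mono) auto
        moreover have "2 * pi / (5 * a) * \<bar>s - z j\<bar> \<le> 2 * pi / (5 * a) * (4 * a)"
          using s z_mem a by (intro mult_left_mono) auto
        ultimately have "\<kappa> \<le> 1 - cos (2 * pi * t j)"
          using a unfolding tz by (intro \<kappa>(2)) (auto simp: abs_mult)
        then have "2 * G / \<kappa> * \<kappa> \<le> 2 * G / \<kappa> * (1 - cos (2 * pi * t j))"
          using G \<kappa> by (intro mult_left_mono) auto
        then have "2 * G \<le> 2 * G / \<kappa> * (1 - cos (2 * pi * t j))"
          using \<kappa>(1) by simp
        moreover have "cmod (g s - of_real \<theta> * g (z j)) \<le> cmod (g s) + \<theta> * cmod (g (z j))"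
          using norm_triangle_ineq4[of "g s" "of_real \<theta> * g (z j)"] \<theta>(1) by (simp add: norm_mult)
        moreover have "\<theta> * cmod (g (z j)) \<le> G"
          using G(2)[OF z_mem] \<theta> by (intro order_trans[OF mult_left_le_one_le]) auto
        ultimately show ?thesis
          using G(2)[OF s_mem] e unfolding \<theta>_def by linarith
      qed
    qed
    have "(\<Sum>q<N. \<Sum>i<4 * N. g (real (i + q) * a / real N)
      * of_real (fejer N (s / (5 * a) - real (i + q) / real (5 * N)) / real (5 * N * N)))
        = (\<Sum>j<5 * N. of_nat (n j) * (g (z j) * of_real (w j / real N)))"
      using sum_diagonals[where f = "\<lambda>j. g (z j) * of_real (w j / real N)" and N = N and m = "4 * N"]
      by (simp add: n_def z_def w_def t_def)
    \<comment> \<open>The weights \<open>w j\<close> sum to 1, so \<open>g s\<close> can be moved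
      inside the sum.\<close>
    then have "cmod (g s - (\<Sum>q<N. \<Sum>i<4 * N. g (real (i + q) * a / real N)
      * of_real (fejer N (s / (5 * a) - real (i + q) / real (5 * N)) / real (5 * N * N))))
        = cmod (g s * of_real (\<Sum>j<5 * N. w j) - (\<Sum>j<5 * N. of_nat (n j) * (g (z j) * of_real (w j / real N))))"
      by (simp add: w_sum)
    also have "\<dots> = cmod (\<Sum>j<5 * N. of_real (w j) * (g s - of_real (real (n j) / real N) * g (z j)))"
      by (rule arg_cong[of _ _ cmod])
        (simp add: sum_distrib_left algebra_simps flip: sum_subtractf)
    also have "\<dots> \<le> (\<Sum>j<5 * N. w j * (3 * \<epsilon> / 4 + 2 * G / \<kappa> * (1 - cos (2 * pi * t j))))"
    proof (rule sum_norm_le)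
      fix j assume "j \<in> {..<5 * N}"
      then show "cmod (of_real (w j) * (g s - of_real (real (n j) / real N) * g (z j)))
          \<le> w j * (3 * \<epsilon> / 4 + 2 * G / \<kappa> * (1 - cos (2 * pi * t j)))"
        unfolding norm_mult norm_of_real abs_of_nonneg[OF w_nonneg]
        using err by (intro mult_left_mono w_nonneg) auto
    qed
    also have "\<dots> = 3 * \<epsilon> / 4 * (\<Sum>j<5 * N. w j) + 2 * G / \<kappa> * (\<Sum>j<5 * N. w j * (1 - cos (2 * pi * t j)))"
      unfolding sum_distrib_left sum.distrib[symmetric] by (rule sum.cong) (auto simp: algebra_simps)
    also have "\<dots> \<le> \<epsilon>"
      unfolding w_sum w_cos using N2 by simp
    finally show "cmod (g s - (\<Sum>q<N. \<Sum>i<4 * N. g (real (i + q) * a / real N)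
      * of_real (fejer N (s / (5 * a) - real (i + q) / real (5 * N)) / real (5 * N * N)))) \<le> \<epsilon>" .
  qed (use N in simp)
qed

subsection \<open>Transference\<close>

lemma C0_semigroupD:
  assumes "C0_semigroup T"
  shows "0 \<le> s \<Longrightarrow> bounded_linear (T s)"
    and "0 \<le> s \<Longrightarrow> T s (a *\<^sub>C x) = a *\<^sub>C T s x"
    and "T 0 x = x"
    and "0 \<le> s \<Longrightarrow> 0 \<le> t \<Longrightarrow> T (s + t) x = T s (T t x)"
    and "continuous_on {0..} (\<lambda>s. T s x)"
  using assms unfolding C0_semigroup_def by blast+

lemma continuous_on_orbit:
  assumes "C0_semigroup T"
  shows "continuous_on {0..} (\<lambda>s. cinner (T s x) y)"
  using bounded_linear.continuous_on[OF bounded_linear_cinner_left C0_semigroupD(5)[OF assms]] .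

text \<open>Sampled on the grid, the coefficients \<open>\<langle>T(ih)x, T(qh)\<^sup>* y\<rangle>\<close> have a finite Fourier transform that
  factorises. The constant is \<open>2 = sqrt (4 N) * sqrt N / N\<close>.\<close>

lemma orbit_exponential_approximation:
  fixes T :: "real \<Rightarrow> 'a::chilbert_space \<Rightarrow> 'a"
  assumes T: "C0_semigroup T" and a: "0 < a" and e: "0 < \<epsilon>" and C: "0 \<le> C\<^sub>1" "0 \<le> C\<^sub>2"
    and C1: "\<And>s x. 0 \<le> s \<Longrightarrow> s \<le> a \<Longrightarrow> norm (T s x) \<le> C\<^sub>1 * norm x"
    and C2: "\<And>s x. 0 \<le> s \<Longrightarrow> s \<le> 4 * a \<Longrightarrow> norm (T s x) \<le> C\<^sub>2 * norm x"
  shows "\<exists>(N::nat) c \<theta>.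
    (\<forall>s\<in>{a..4 * a}. cmod (cinner (T s x) y - (\<Sum>k<N. \<Sum>l<N. c k l * cis (\<theta> k l * s))) \<le> \<epsilon>) \<and>
    (\<Sum>k<N. \<Sum>l<N. cmod (c k l)) \<le> 2 * C\<^sub>1 * C\<^sub>2 * norm x * norm y"
proof -
  define g where "g s = cinner (T s x) y" for s
  have "continuous_on {0..5 * a} g"
    unfolding g_def by (rule continuous_on_subset[OF continuous_on_orbit[OF T]]) auto
  then obtain N where N: "0 < N" and approx: "\<And>s. s \<in> {a..4 * a} \<Longrightarrow>
    cmod (g s - (\<Sum>q<N. \<Sum>i<4 * N. g (real (i + q) * a / real N)
      * of_real (fejer N (s / (5 * a) - real (i + q) / real (5 * N)) / real (5 * N * N)))) \<le> \<epsilon>"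
    using sampled_fejer_approximation[OF a _ e] by blast
  define h where "h = a / real N"
  have h: "0 \<le> real i * h" for i
    using a by (simp add: h_def)
  define u where "u i = T (real i * h) x" for i
  have h_le: "real i * h \<le> real m * a" if "i \<le> m * N" for i m
  proof -
    have "real i \<le> real m * real N"
      using that by (simp flip: of_nat_mult)
    then have "real i * h \<le> real m * real N * h"
      using a by (intro mult_right_mono) (auto simp: h_def)
    then show ?thesis
      using N by (simp add: h_def)
  qed
  \<comment> \<open>For \<open>q < N\<close> the time \<open>q * h\<close> is at most
    \<open>a\<close>, so the adjoint vectors are governed by \<open>C\<^sub>1\<close>; the times
    \<open>i * h\<close> with \<open>i < 4 * N\<close> fall under \<open>C\<^sub>2\<close>.\<close>
  have "\<exists>v. (\<forall>x. cinner (T (real q * h) x) y = cinner x v) \<and> norm v \<le> C\<^sub>1 * norm y" if "q < N" for q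
    using h h_le[of q 1] that C
    by (intro adjoint_exists C0_semigroupD[OF T] C1) auto
  then obtain v where v: "\<And>q x. q < N \<Longrightarrow> cinner (T (real q * h) x) y = cinner x (v q)"
    and norm_v: "\<And>q. q < N \<Longrightarrow> norm (v q) \<le> C\<^sub>1 * norm y"
    by metis
  have norm_u: "norm (u i) \<le> C\<^sub>2 * norm x" if "i < 4 * N" for i
    unfolding u_def using h h_le[of i 4] that by (intro C2) auto
  have g_uv: "g (real (i + q) * a / real N) = cinner (u i) (v q)" if "q < N" for i q
  proof -
    have "real (i + q) * a / real N = real q * h + real i * h"
      by (simp add: h_def algebra_simps add_divide_distrib)
    then show ?thesis
      using C0_semigroupD(4)[OF T h h] v[OF that] by (simp add: g_def u_def)
  qed
  \<comment> \<open>The signs are opposite because \<open>cinner\<close> conjugates its second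
    argument: in \<open>cinner (U k l) (V k l)\<close> both phases then carry
    \<open>-(k - l)\<close>, and the indices combine to \<open>i + q\<close>.\<close>
  define U where "U k l = (\<Sum>i<4 * N. cis (2 * pi * (real k - real l) * ((- 1 :: int) * real i) / real (5 * N)) *\<^sub>C u i)" for k l
  define V where "V k l = (\<Sum>q<N. cis (2 * pi * (real k - real l) * ((1 :: int) * real q) / real (5 * N)) *\<^sub>C v q)" for k l
  \<comment> \<open>One factor \<open>N\<close> is the normalisation of the kernel, the remaining
    \<open>5 * N * N\<close> that of the sampled mean.\<close>
  define c where "c k l = cinner (U k l) (V k l) / of_nat (5 * N * N * N)" for k l
  define \<theta> where "\<theta> k l = 2 * pi * (real k - real l) / (5 * a)" for k l :: nat
  have sum_le: "(\<Sum>k<N. \<Sum>l<N. cmod (c k l)) \<le> 2 * C\<^sub>1 * C\<^sub>2 * norm x * norm y"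
  proof -
    define R where "R = sqrt (real (5 * N * N))"
    have R: "0 \<le> R" "R\<^sup>2 = real (5 * N * N)"
      by (simp_all add: R_def)
    \<comment> \<open>For fixed \<open>l\<close> the sum over \<open>k < N\<close> is enlarged to a
      full period \<open>5 * N\<close>, where Parseval applies. The orbit has four times as many
      samples as the adjoint orbit, which gives the factor 2.\<close>
    have col: "(\<Sum>k<N. cmod (c k l)) \<le> 2 * C\<^sub>1 * C\<^sub>2 * norm x * norm y / real N" for l
    proof -
      have "(\<Sum>k<5 * N. (norm (U k l))\<^sup>2) = real (5 * N) * (\<Sum>i<4 * N. (norm (u i))\<^sup>2)"
        unfolding U_def by (rule parseval) auto
      also have "\<dots> \<le> real (5 * N) * (\<Sum>i<4 * N. (C\<^sub>2 * norm x)\<^sup>2)"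
        by (intro mult_left_mono sum_mono power_mono norm_u) auto
      also have "\<dots> = (2 * R * (C\<^sub>2 * norm x))\<^sup>2"
        by (simp add: power_mult_distrib R)
      finally have U: "(\<Sum>k<5 * N. (norm (U k l))\<^sup>2) \<le> (2 * R * (C\<^sub>2 * norm x))\<^sup>2" .
      have "(\<Sum>k<5 * N. (norm (V k l))\<^sup>2) = real (5 * N) * (\<Sum>q<N. (norm (v q))\<^sup>2)"
        unfolding V_def by (rule parseval) auto
      also have "\<dots> \<le> real (5 * N) * (\<Sum>q<N. (C\<^sub>1 * norm y)\<^sup>2)"
        by (intro mult_left_mono sum_mono power_mono norm_v) auto
      also have "\<dots> = (R * (C\<^sub>1 * norm y))\<^sup>2"
        by (simp add: power_mult_distrib R)
      finally have V: "(\<Sum>k<5 * N. (norm (V k l))\<^sup>2) \<le> (R * (C\<^sub>1 * norm y))\<^sup>2" .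
      have "(\<Sum>k<N. cmod (cinner (U k l) (V k l))) \<le> (\<Sum>k<5 * N. cmod (cinner (U k l) (V k l)))"
        by (rule sum_mono2) auto
      also have "\<dots> \<le> 2 * R * (C\<^sub>2 * norm x) * (R * (C\<^sub>1 * norm y))"
        using C R by (intro sum_cmod_cinner_le U V) auto
      also have "\<dots> = R\<^sup>2 * (2 * C\<^sub>1 * C\<^sub>2 * norm x * norm y)"
        by (simp add: power2_eq_square)
      finally have "(\<Sum>k<N. cmod (cinner (U k l) (V k l))) \<le> real (5 * N * N) * (2 * C\<^sub>1 * C\<^sub>2 * norm x * norm y)"
        unfolding R .
      then have "(\<Sum>k<N. cmod (cinner (U k l) (V k l))) / real (5 * N * N * N)
          \<le> real (5 * N * N) * (2 * C\<^sub>1 * C\<^sub>2 * norm x * norm y) / real (5 * N * N * N)"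
        by (rule divide_right_mono) simp
      then show ?thesis
        using N by (simp add: c_def norm_divide norm_mult sum_divide_distrib)
    qed
    have "(\<Sum>k<N. \<Sum>l<N. cmod (c k l)) = (\<Sum>l<N. \<Sum>k<N. cmod (c k l))"
      by (rule sum.swap)
    also have "\<dots> \<le> (\<Sum>l<N. 2 * C\<^sub>1 * C\<^sub>2 * norm x * norm y / real N)"
      by (intro sum_mono col)
    also have "\<dots> = 2 * C\<^sub>1 * C\<^sub>2 * norm x * norm y"
      using N by simp
    finally show ?thesis .
  qed
  have expand: "(\<Sum>q<N. \<Sum>i<4 * N. g (real (i + q) * a / real N)
      * of_real (fejer N (s / (5 * a) - real (i + q) / real (5 * N)) / real (5 * N * N)))
    = (\<Sum>k<N. \<Sum>l<N. c k l * cis (\<theta> k l * s))" for s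
  proof -
    define E where "E k l i q = cis (2 * pi * (real k - real l) * ((- 1 :: int) * real i) / real (5 * N))
      * cnj (cis (2 * pi * (real k - real l) * ((1 :: int) * real q) / real (5 * N)))" for k l i q
    have E: "cis (2 * pi * (real k - real l) * (s / (5 * a) - real (i + q) / real (5 * N)))
        = E k l i q * cis (\<theta> k l * s)" for k l i q
      unfolding E_def cis_cnj cis_mult
      by (rule arg_cong[of _ _ cis]) (use N a in \<open>simp add: \<theta>_def field_simps\<close>)
    have UV: "cinner (U k l) (V k l) = (\<Sum>i<4 * N. \<Sum>q<N. E k l i q * cinner (u i) (v q))" for k l
      unfolding U_def cinner_sum_left cinner_scaleC_left V_def
      by (simp add: E_def cinner_sum_right cinner_scaleC_right sum_distrib_left mult.assoc)
    have "(\<Sum>q<N. \<Sum>i<4 * N. g (real (i + q) * a / real N)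
        * of_real (fejer N (s / (5 * a) - real (i + q) / real (5 * N)) / real (5 * N * N)))
      = (\<Sum>q<N. \<Sum>i<4 * N. cinner (u i) (v q)
        * of_real (fejer N (s / (5 * a) - real (i + q) / real (5 * N)) / real (5 * N * N)))"
      by (intro sum.cong refl) (simp only: g_uv lessThan_iff)
    also have "\<dots> = (\<Sum>q<N. \<Sum>i<4 * N. \<Sum>k<N. \<Sum>l<N.
          E k l i q * cinner (u i) (v q) * cis (\<theta> k l * s) / of_nat (5 * N * N * N))"
      unfolding of_real_divide fejer_expand E
      by (intro sum.cong refl) (simp add: sum_divide_distrib sum_distrib_left mult_ac)
    also have "\<dots> = (\<Sum>q<N. \<Sum>k<N. \<Sum>i<4 * N. \<Sum>l<N.
          E k l i q * cinner (u i) (v q) * cis (\<theta> k l * s) / of_nat (5 * N * N * N))"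
      by (intro sum.cong refl sum.swap)
    also have "\<dots> = (\<Sum>k<N. \<Sum>q<N. \<Sum>i<4 * N. \<Sum>l<N.
          E k l i q * cinner (u i) (v q) * cis (\<theta> k l * s) / of_nat (5 * N * N * N))"
      by (rule sum.swap)
    also have "\<dots> = (\<Sum>k<N. \<Sum>q<N. \<Sum>l<N. \<Sum>i<4 * N.
          E k l i q * cinner (u i) (v q) * cis (\<theta> k l * s) / of_nat (5 * N * N * N))"
      by (intro sum.cong refl sum.swap)
    also have "\<dots> = (\<Sum>k<N. \<Sum>l<N. \<Sum>q<N. \<Sum>i<4 * N.
          E k l i q * cinner (u i) (v q) * cis (\<theta> k l * s) / of_nat (5 * N * N * N))"
      by (intro sum.cong refl sum.swap)
    also have "\<dots> = (\<Sum>k<N. \<Sum>l<N. \<Sum>i<4 * N. \<Sum>q<N.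
          E k l i q * cinner (u i) (v q) * cis (\<theta> k l * s) / of_nat (5 * N * N * N))"
      by (intro sum.cong refl sum.swap)
    also have "\<dots> = (\<Sum>k<N. \<Sum>l<N. c k l * cis (\<theta> k l * s))"
      unfolding c_def UV sum_divide_distrib sum_distrib_right times_divide_eq_left ..
    finally show ?thesis .
  qed
  have "cmod (g s - (\<Sum>k<N. \<Sum>l<N. c k l * cis (\<theta> k l * s))) \<le> \<epsilon>" if "s \<in> {a..4 * a}" for s
    using approx[OF that] unfolding expand .
  then show ?thesis
    using sum_le unfolding g_def by blast
qed

subsection \<open>The dyadic partition of unity\<close>

text \<open>Rises linearly from 0 at \<open>2 powi (n - 1)\<close> to 1 at \<open>2 powi n\<close>;
  sums of \<open>phi\<close> telescope in terms of it.\<close>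

definition ramp :: "int \<Rightarrow> real \<Rightarrow> real"
  where "ramp n s = max 0 (min 1 (s / 2 powi (n - 1) - 1))"

lemma phi_eq_ramp_diff: "phi n s = ramp n s - ramp (n + 1) s"
proof -
  define a :: real where "a = 2 powi (n - 1)"
  have a: "0 < a" "2 powi n = 2 * a" "2 powi (n + 1) = 4 * a" "2 powi (n + 1 - 1) = 2 * a"
    by (simp_all add: a_def power_int_diff power_int_add)
  show ?thesis
    unfolding phi_def ramp_def a(2-) a_def[symmetric]
    using a(1) by (auto simp: min_def max_def field_simps)
qed

lemma ramp_bounds: "0 \<le> ramp n s" "ramp n s \<le> 1"
  by (auto simp: ramp_def)

lemma ramp_Suc_le:
  assumes "0 \<le> s"
  shows "ramp (n + 1) s \<le> ramp n s"
proof -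
  have "s / 2 powi (n + 1 - 1) \<le> s / 2 powi (n - 1)"
    using assms by (intro divide_left_mono) (auto simp: power_int_diff)
  then show ?thesis
    unfolding ramp_def by (intro max.mono min.mono) auto
qed

lemma phi_bounds:
  assumes "0 \<le> s"
  shows "0 \<le> phi n s" "phi n s \<le> 1"
  using ramp_bounds[of n s] ramp_bounds[of "n + 1" s] ramp_Suc_le[OF assms, of n]
  unfolding phi_eq_ramp_diff by linarith+

lemma continuous_on_phi: "continuous_on S (phi n)"
  unfolding phi_eq_ramp_diff[abs_def] ramp_def by (intro continuous_intros) auto

lemma phi_eq_0: "s \<notin> {2 powi (n - 1)..4 * 2 powi (n - 1)} \<Longrightarrow> phi n s = 0"
  by (auto simp: phi_def power_int_diff power_int_add)

lemma sum_phi: "(\<Sum>n\<in>{- int N..int N}. phi n s) = ramp (- int N) s - ramp (int N + 1) s"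
proof (induction N)
  case 0
  then show ?case
    by (simp add: phi_eq_ramp_diff)
next
  case (Suc N)
  have "{- int (Suc N)..int (Suc N)} = insert (- int (Suc N)) (insert (int (Suc N)) {- int N..int N})"
    by auto
  then have "(\<Sum>n\<in>{- int (Suc N)..int (Suc N)}. phi n s)
      = phi (- int (Suc N)) s + (phi (int (Suc N)) s + (\<Sum>n\<in>{- int N..int N}. phi n s))"
    by simp
  also have "\<dots> = ramp (- int (Suc N)) s - ramp (int (Suc N) + 1) s"
    unfolding Suc unfolding phi_eq_ramp_diff by (simp add: add.commute)
  finally show ?case .
qed

lemma sum_phi_tendsto:
  assumes "0 < s"
  shows "(\<lambda>N. \<Sum>n\<in>{- int N..int N}. phi n s) \<longlonglongrightarrow> 1"
proof -
  \<comment> \<open>Beyond \<open>N1\<close> the lower ramp has reached 1 at \<open>s\<close> and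
    the upper one has not yet left 0.\<close>
  obtain N1 where N1: "max s (2 / s) < 2 ^ N1"
    using real_arch_pow[of 2 "max s (2 / s)"] by auto
  have "(\<Sum>n\<in>{- int N..int N}. phi n s) = 1" if "N1 \<le> N" for N
  proof -
    have "max s (2 / s) \<le> 2 ^ N"
      using less_le_trans[OF N1 power_increasing[OF that, of "2 :: real"]] by simp
    then have *: "s \<le> 2 ^ N" "2 \<le> s * 2 ^ N"
      using assms by (simp_all add: pos_divide_le_eq mult.commute)
    have "- int N - 1 = - int (Suc N)"
      by simp
    then have "2 powi (- int N - 1) = inverse (2 * 2 ^ N :: real)"
      by (simp only: power_int_minus power_int_of_nat power_Suc)
    moreover have "2 powi (int N + 1 - 1) = (2 ^ N :: real)"
      by simp
    ultimately have "ramp (- int N) s = max 0 (min 1 (s * (2 * 2 ^ N) - 1))" "ramp (int N + 1) s = max 0 (min 1 (s / 2 ^ N - 1))"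
      unfolding ramp_def by (simp_all only: divide_inverse inverse_inverse_eq)
    moreover have "s / 2 ^ N \<le> 1"
      using * by (simp add: field_simps)
    ultimately show ?thesis
      unfolding sum_phi using * by (simp add: max_def min_def)
  qed
  then show ?thesis
    by (intro tendsto_eventually eventually_sequentiallyI[of N1])
qed

text \<open>Source of the base 9. If \<open>n < 0\<close> then \<open>a \<le> 1 / 4\<close> and the
  product of the two bases is at most 4. Otherwise \<open>1 \<le> 2 * a\<close>, and the product is
  at most \<open>18 * a^2\<close>, which is below 9 times the square of
  \<open>2 powi n = 2 * a\<close>.\<close>

lemma dyadic_weight_bound:
  fixes \<alpha> :: real and n :: int
  assumes "0 \<le> \<alpha>"
  defines "a \<equiv> 2 powi (n - 1) :: real"
  shows "(1 + a) powr \<alpha> * (1 + 4 * a) powr \<alpha> \<le> 9 powr \<alpha> * (if n < 0 then 1 else 2 powr (real_of_int n * (2 * \<alpha>)))"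
proof -
  have a: "0 < a" "2 powi n = 2 * a"
    by (simp_all add: a_def power_int_diff)
  have "(1 + a) powr \<alpha> * (1 + 4 * a) powr \<alpha> = ((1 + a) * (1 + 4 * a)) powr \<alpha>"
    using a by (simp add: powr_mult)
  also have "\<dots> \<le> 9 powr \<alpha> * (if n < 0 then 1 else 2 powr (real_of_int n * (2 * \<alpha>)))"
  proof (cases "n < 0")
    case True
    have "2 powi n \<le> (2 powi (- 1) :: real)"
      using True by (intro power_int_increasing) auto
    then have "a \<le> 1 / 4"
      using a by (simp add: power_int_minus)
    then have "(1 + a) * (1 + 4 * a) \<le> 2 * 2"
      using a by (intro mult_mono) auto
    then show ?thesis
      using True a assms(1) by (auto intro!: powr_mono2)
  next
    case False
    have "2 powi 0 \<le> (2 powi n :: real)"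
      using False by (intro power_int_increasing) auto
    then have "1 \<le> 2 * a"
      using a by simp
    then have "(1 + a) * (1 + 4 * a) \<le> (3 * a) * (6 * a)"
      using a by (intro mult_mono) auto
    also have "\<dots> \<le> 9 * (2 powi n)\<^sup>2"
      unfolding a(2) by (simp add: power2_eq_square)
    finally have "((1 + a) * (1 + 4 * a)) powr \<alpha> \<le> (9 * (2 powi n)\<^sup>2) powr \<alpha>"
      using a assms(1) by (intro powr_mono2) auto
    also have "\<dots> = 9 powr \<alpha> * ((2 powi n)\<^sup>2) powr \<alpha>"
      by (simp add: powr_mult)
    also have "((2 powi n)\<^sup>2) = (2 :: real) powr (real_of_int n * 2)"
      by (simp add: powr_mult_base powr_real_of_int' power2_eq_square flip: powr_powr powr_add)
    finally show ?thesis
      using False by (simp add: powr_powr mult.assoc)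
  qed
  finally show ?thesis .
qed

subsection \<open>Dyadic blocks of the functional calculus\<close>

lemma space_half_line [simp]: "space half_line = {0..}"
  by (simp add: space_restrict_space)

lemma bdd_measurable_continuous:
  assumes "continuous_on {0..} g" "\<And>s. 0 \<le> s \<Longrightarrow> cmod (g s) \<le> C"
  shows "bdd_measurable half_line g"
  using assms by (intro bdd_measurableI[of _ _ C] borel_measurable_continuous_on_restrict) auto

lemma bdd_measurable_exp: "0 \<le> Re z \<Longrightarrow> bdd_measurable half_line (\<lambda>s. exp (- z * of_real s))"
  by (rule bdd_measurable_continuous[of _ 1]) (auto intro!: continuous_intros)

lemma bdd_measurable_phi: "bdd_measurable half_line (\<lambda>s. of_real (phi n s))"
  by (rule bdd_measurable_continuous[of _ 1])
    (auto intro!: continuous_intros continuous_on_phi simp: phi_bounds)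

lemma bdd_measurable_cis: "bdd_measurable half_line (\<lambda>s. cis (t * s))"
  by (rule bdd_measurable_continuous[of _ 1]) (auto simp: cis_conv_exp intro!: continuous_intros)

section \<open>Laplace transforms on the half-line and a single dyadic block\<close>

locale half_line_measure = complex_measure half_line \<mu> for \<mu> :: "real set \<Rightarrow> complex"
begin

lemma cmod_laplace_le: "0 \<le> Re z \<Longrightarrow> cmod (laplace \<mu> z) \<le> tv"
  using cm_integral_bound[OF bdd_measurable_exp, of z 1] by (simp add: laplace_def)

lemma Hinf_norm_laplace_finite: "Hinf_norm (laplace \<mu>) < top"
proof -
  have "Hinf_norm (laplace \<mu>) \<le> ennreal tv"
    unfolding Hinf_norm_def by (rule SUP_least) (auto intro!: ennreal_leI cmod_laplace_le)
  then show ?thesis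
    by (rule le_less_trans) simp
qed

lemma cmod_laplace_le_Hinf_norm:
  assumes "0 < Re z"
  shows "cmod (laplace \<mu> z) \<le> enn2real (Hinf_norm (laplace \<mu>))"
proof -
  have "ennreal (cmod (laplace \<mu> z)) \<le> Hinf_norm (laplace \<mu>)"
    unfolding Hinf_norm_def by (rule SUP_upper) (use assms in auto)
  from enn2real_mono[OF this Hinf_norm_laplace_finite] show ?thesis
    by simp
qed

lemma cmod_integral_cis_le: "cmod (cm_integral half_line \<mu> (\<lambda>s. cis (t * s))) \<le> enn2real (Hinf_norm (laplace \<mu>))"
proof -
  \<comment> \<open>The points \<open>z n\<close> approach the imaginary axis from the right, so
    dominated convergence carries the supremum bound over to the boundary.\<close>
  define z where "z n = of_real (1 / real (Suc n)) - \<i> * of_real t" for n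
  have z: "0 < Re (z n)" for n
    by (simp add: z_def)
  have "z \<longlonglongrightarrow> of_real 0 - \<i> * of_real t"
    unfolding z_def using LIMSEQ_inverse_real_of_nat
    by (intro tendsto_intros) (simp add: inverse_eq_divide)
  then have "(\<lambda>n. exp (- z n * of_real s)) \<longlonglongrightarrow> exp (- (of_real 0 - \<i> * of_real t) * of_real s)" for s
    by (intro tendsto_intros)
  then have lim: "(\<lambda>n. exp (- z n * of_real s)) \<longlonglongrightarrow> cis (t * s)" for s
    by (simp add: cis_conv_exp mult.assoc)
  have "(\<lambda>n. laplace \<mu> (z n)) \<longlonglongrightarrow> cm_integral half_line \<mu> (\<lambda>s. cis (t * s))"
    unfolding laplace_def
    by (rule cm_integral_tendsto[where C = 1, OF bdd_measurable_exp bdd_measurable_cis])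
      (use z lim in \<open>simp_all add: less_imp_le\<close>)
  from tendsto_norm[OF this] show ?thesis
    by (rule LIMSEQ_le_const2) (auto intro: cmod_laplace_le_Hinf_norm[OF z])
qed

text \<open>The exponentials decrease to the indicator of \<open>{0}\<close>, so the value at
  infinity is the atom of \<open>\<mu>\<close> at 0.\<close>

lemma laplace_tendsto: "((\<lambda>t::real. laplace \<mu> (of_real t)) \<longlongrightarrow> \<mu> {0}) at_top"
proof (rule tendsto_at_topI_sequentially)
  fix X :: "nat \<Rightarrow> real" assume X: "filterlim X at_top sequentially"
  \<comment> \<open>Finitely many \<open>X n\<close> may be negative, where the exponential is
    unbounded in \<open>s\<close>; \<open>max 0\<close> keeps the bound 1 for dominated
    convergence.\<close>
  have lim: "(\<lambda>n. exp (- of_real (max 0 (X n)) * of_real s)) \<longlonglongrightarrow> (indicator {0} s :: complex)" if "0 \<le> s" for s :: real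
  proof (cases "s = 0")
    case False
    have "filterlim (\<lambda>n. max 0 (X n)) at_top sequentially"
      by (rule filterlim_at_top_mono[OF X]) simp
    then have "filterlim (\<lambda>n. max 0 (X n) * s) at_top sequentially"
      using False that by (intro filterlim_at_top_mult_tendsto_pos[OF tendsto_const]) auto
    then have "filterlim (\<lambda>n. - (max 0 (X n) * s)) at_bot sequentially"
      by (simp add: filterlim_uminus_at_bot)
    then have "(\<lambda>n. exp (- (max 0 (X n) * s))) \<longlonglongrightarrow> 0"
      by (rule filterlim_compose[OF exp_at_bot])
    then have "(\<lambda>n. complex_of_real (exp (- (max 0 (X n) * s)))) \<longlonglongrightarrow> of_real 0"
      by (rule tendsto_of_real)
    then show ?thesis
      using False by (simp add: exp_of_real[symmetric])
  qed simp
  have zero: "{0} \<in> sets half_line"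
    by (simp add: sets_restrict_space_iff)
  have "(\<lambda>n. laplace \<mu> (of_real (max 0 (X n)))) \<longlonglongrightarrow> cm_integral half_line \<mu> (indicator {0})"
    unfolding laplace_def
    by (rule cm_integral_tendsto[where C = 1, OF bdd_measurable_exp bdd_measurable_indicator[OF zero]])
      (use lim in simp_all)
  then have "(\<lambda>n. laplace \<mu> (of_real (max 0 (X n)))) \<longlonglongrightarrow> \<mu> {0}"
    by (simp add: cm_integral_indicator[OF zero])
  moreover have "\<forall>\<^sub>F n in sequentially. 0 \<le> X n"
    using X by (simp add: filterlim_at_top)
  then have "\<forall>\<^sub>F n in sequentially. laplace \<mu> (of_real (max 0 (X n))) = laplace \<mu> (of_real (X n))"
    by eventually_elim (simp add: max_def)
  ultimately show "(\<lambda>n. laplace \<mu> (of_real (X n))) \<longlonglongrightarrow> \<mu> {0}"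
    by (rule Lim_transform_eventually)
qed

text \<open>On the support of \<open>phi n\<close> the orbit is replaced by an exponential
  polynomial; each of its terms costs the modulus of its coefficient times the norm of the transform
  of the block.\<close>

lemma dyadic_block_bound:
  fixes T :: "real \<Rightarrow> 'a::chilbert_space \<Rightarrow> 'a" and n :: int
  assumes T: "C0_semigroup T" and C: "0 \<le> C\<^sub>1" "0 \<le> C\<^sub>2"
  defines "a \<equiv> 2 powi (n - 1) :: real"
  assumes C1: "\<And>s x. 0 \<le> s \<Longrightarrow> s \<le> a \<Longrightarrow> norm (T s x) \<le> C\<^sub>1 * norm x"
    and C2: "\<And>s x. 0 \<le> s \<Longrightarrow> s \<le> 4 * a \<Longrightarrow> norm (T s x) \<le> C\<^sub>2 * norm x"
  shows "cmod (cm_integral half_line \<mu> (\<lambda>s. cinner (T s x) y * of_real (phi n s)))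
    \<le> 2 * C\<^sub>1 * C\<^sub>2 * norm x * norm y
      * enn2real (Hinf_norm (laplace (cm_density half_line (\<lambda>s. of_real (phi n s)) \<mu>)))"
    (is "_ \<le> ?D * ?H")
proof (rule field_le_epsilon)
  fix e :: real assume e: "0 < e"
  let ?\<nu> = "cm_density half_line (\<lambda>s. of_real (phi n s)) \<mu>"
  interpret \<nu>: half_line_measure ?\<nu>
    unfolding half_line_measure_def by (rule cm_density_complex_measure[OF bdd_measurable_phi])
  have a: "0 < a"
    by (simp add: a_def)
  \<comment> \<open>Adding 1 keeps the quotient meaningful when \<open>tv\<close> is 0.\<close>
  define \<epsilon> where "\<epsilon> = e / (tv + 1)"
  have \<epsilon>: "0 < \<epsilon>" "tv * \<epsilon> \<le> e"
    using e tv_nonneg by (auto simp: \<epsilon>_def field_simps)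
  obtain N c \<theta> where
    approx: "\<And>s. s \<in> {a..4 * a} \<Longrightarrow>
      cmod (cinner (T s x) y - (\<Sum>k<(N::nat). \<Sum>l<N. c k l * cis (\<theta> k l * s))) \<le> \<epsilon>"
    and c: "(\<Sum>k<N. \<Sum>l<N. cmod (c k l)) \<le> ?D"
    using orbit_exponential_approximation[OF T a \<epsilon>(1) C C1 C2, of x y] by blast
  define p where "p s = (\<Sum>k<N. \<Sum>l<N. c k l * cis (\<theta> k l * s))" for s
  have p: "bdd_measurable half_line p"
    unfolding p_def by (intro bdd_measurable_sum bdd_measurable_mult bdd_measurable_const bdd_measurable_cis)
  have g: "bdd_measurable half_line (\<lambda>s. cinner (T s x) y * of_real (phi n s))"
  proof (rule bdd_measurable_continuous)
    show "continuous_on {0..} (\<lambda>s. cinner (T s x) y * of_real (phi n s))"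
      by (intro continuous_intros continuous_on_orbit[OF T] continuous_on_phi)
    \<comment> \<open>Past \<open>4 * a\<close> the orbit is not controlled by
      \<open>C\<^sub>2\<close>, but there \<open>phi n\<close> vanishes.\<close>
    show "cmod (cinner (T s x) y * of_real (phi n s)) \<le> C\<^sub>2 * norm x * norm y" if "0 \<le> s" for s
    proof (cases "s \<le> 4 * a")
      case True
      have "cmod (cinner (T s x) y) \<le> C\<^sub>2 * norm x * norm y"
        by (rule order_trans[OF cmod_cinner_le mult_right_mono]) (use C2 that True in auto)
      then have "cmod (cinner (T s x) y) * phi n s \<le> C\<^sub>2 * norm x * norm y * 1"
        using phi_bounds[OF that, of n] C by (intro mult_mono) auto
      then show ?thesis
        using phi_bounds[OF that, of n] by (simp add: norm_mult)
    qed (use C in \<open>simp add: phi_eq_0 a_def\<close>)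
  qed
  have ph: "bdd_measurable half_line (\<lambda>s. p s * of_real (phi n s))"
    by (intro bdd_measurable_mult p bdd_measurable_phi)
  have "cmod (cm_integral half_line \<mu> (\<lambda>s. cinner (T s x) y * of_real (phi n s))
      - cm_integral half_line \<mu> (\<lambda>s. p s * of_real (phi n s))) \<le> tv * \<epsilon>"
    unfolding cm_integral_diff[OF g ph, symmetric]
  proof (rule cm_integral_bound[OF bdd_measurable_diff[OF g ph]])
    fix s assume "s \<in> space half_line"
    then have s: "0 \<le> s"
      by simp
    show "cmod (cinner (T s x) y * of_real (phi n s) - p s * of_real (phi n s)) \<le> \<epsilon>"
    proof (cases "s \<in> {a..4 * a}")
      case True
      have "cmod (cinner (T s x) y - p s) * phi n s \<le> \<epsilon> * 1"
        using approx[OF True] phi_bounds[OF s, of n] \<epsilon> by (intro mult_mono) (auto simp: p_def)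
      then show ?thesis
        using phi_bounds[OF s, of n] by (simp add: norm_mult flip: left_diff_distrib)
    qed (use \<epsilon> in \<open>simp add: phi_eq_0 a_def\<close>)
  qed
  moreover have "cmod (cm_integral half_line \<mu> (\<lambda>s. p s * of_real (phi n s))) \<le> ?D * ?H"
  proof -
    have "cm_integral half_line \<mu> (\<lambda>s. p s * of_real (phi n s)) = cm_integral half_line ?\<nu> p"
      by (rule cm_integral_density[OF bdd_measurable_phi p, symmetric])
    also have "\<dots> = (\<Sum>k<N. \<Sum>l<N. c k l * cm_integral half_line ?\<nu> (\<lambda>s. cis (\<theta> k l * s)))"
      unfolding p_def
      by (simp add: \<nu>.cm_integral_sum \<nu>.cm_integral_cmult bdd_measurable_sum bdd_measurable_mult
          bdd_measurable_cis)
    also have "cmod \<dots> \<le> (\<Sum>k<N. \<Sum>l<N. cmod (c k l) * ?H)"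
      by (intro sum_norm_le) (simp add: norm_mult mult_left_mono \<nu>.cmod_integral_cis_le)
    also have "\<dots> \<le> ?D * ?H"
      unfolding sum_distrib_right[symmetric] by (rule mult_right_mono[OF c]) simp
    finally show ?thesis .
  qed
  ultimately show "cmod (cm_integral half_line \<mu> (\<lambda>s. cinner (T s x) y * of_real (phi n s))) \<le> ?D * ?H + e"
    using \<epsilon>(2) norm_triangle_sub[of "cm_integral half_line \<mu> (\<lambda>s. cinner (T s x) y * of_real (phi n s))"
        "cm_integral half_line \<mu> (\<lambda>s. p s * of_real (phi n s))"] by linarith
qed

end

lemma sum_le_infsum_ennreal:
  fixes f :: "'b \<Rightarrow> ennreal"
  assumes "finite F" "F \<subseteq> A"
  shows "sum f F \<le> infsum f A"
  using assms by (subst nonneg_infsum_complete) (auto intro: SUP_upper)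

context half_line_measure
begin

lemma compact_support_bounded:
  assumes "compact_support \<mu>"
  shows "\<exists>b\<ge>0. \<forall>B\<in>sets half_line. B \<subseteq> {b<..} \<longrightarrow> \<mu> B = 0"
proof -
  obtain K where K: "compact K" "K \<subseteq> {0..}" "\<And>B. B \<in> sets half_line \<Longrightarrow> B \<inter> K = {} \<Longrightarrow> \<mu> B = 0"
    using assms unfolding compact_support_def by blast
  obtain b where b: "0 < b" "\<And>s. s \<in> K \<Longrightarrow> \<bar>s\<bar> \<le> b"
    using compact_imp_bounded[OF K(1)] unfolding bounded_pos by auto
  have "B \<inter> K = {}" if "B \<subseteq> {b<..}" for B
    using that b(2) by fastforce
  then show ?thesis
    using b(1) K(3) by (intro exI[of _ b]) auto
qed

section \<open>Summation of the blocks for a semigroup of polynomial growth\<close>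

context
  fixes T :: "real \<Rightarrow> 'a::chilbert_space \<Rightarrow> 'a" and \<alpha> M b :: real
  assumes T: "C0_semigroup T" and \<alpha>: "0 \<le> \<alpha>" and M: "1 \<le> M"
    and growth: "\<And>s x. 0 \<le> s \<Longrightarrow> norm (T s x) \<le> M * (1 + s) powr \<alpha> * norm x"
    and b: "0 \<le> b" and null: "\<And>B. B \<in> sets half_line \<Longrightarrow> B \<subseteq> {b<..} \<Longrightarrow> \<mu> B = 0"
begin

text \<open>An orbit may be unbounded on the half-line. Cut off at \<open>b\<close> it becomes
  bounded, and the part removed lies in a null set of \<open>\<mu>\<close>.\<close>

definition cut_orbit :: "'a \<Rightarrow> 'a \<Rightarrow> real \<Rightarrow> complex"
  where "cut_orbit x y s = indicator {..b} s * cinner (T s x) y"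

lemma norm_le_growth:
  assumes "0 \<le> s" "s \<le> t"
  shows "norm (T s x) \<le> M * (1 + t) powr \<alpha> * norm x"
proof -
  have "(1 + s) powr \<alpha> \<le> (1 + t) powr \<alpha>"
    using assms \<alpha> by (intro powr_mono2) auto
  then have "M * (1 + s) powr \<alpha> * norm x \<le> M * (1 + t) powr \<alpha> * norm x"
    using M by (intro mult_right_mono mult_left_mono) auto
  with growth[OF assms(1), of x] show ?thesis
    by linarith
qed

lemma cmod_cut_orbit_le:
  assumes "0 \<le> s"
  shows "cmod (cut_orbit x y s) \<le> M * (1 + b) powr \<alpha> * norm x * norm y"
proof (cases "s \<le> b")
  case True
  then show ?thesis
    using assms by (auto simp: cut_orbit_def intro!: order_trans[OF cmod_cinner_le mult_right_mono] norm_le_growth)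
qed (use M in \<open>simp add: cut_orbit_def\<close>)

lemma measurable_orbit: "(\<lambda>s. cinner (T s x) y) \<in> borel_measurable half_line"
  by (intro borel_measurable_continuous_on_restrict continuous_on_orbit T)

lemma measurable_indicator: "(indicator {..b} :: real \<Rightarrow> complex) \<in> borel_measurable half_line"
  by (rule measurable_restrict_space1) simp

lemma bdd_measurable_cut_orbit: "bdd_measurable half_line (cut_orbit x y)"
proof (rule bdd_measurableI)
  show "cut_orbit x y \<in> borel_measurable half_line"
    unfolding cut_orbit_def[abs_def] by (intro borel_measurable_times measurable_orbit measurable_indicator)
qed (use cmod_cut_orbit_le in simp)

lemma cm_integral_cut:
  assumes "bdd_measurable half_line f"
  shows "cm_integral half_line \<mu> (\<lambda>s. cinner (T s x) y * f s)
    = cm_integral half_line \<mu> (\<lambda>s. cut_orbit x y s * f s)"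
proof (rule cm_integral_cong_null[where N = "{b<..}"])
  show "{b<..} \<in> sets half_line"
    using b by (auto simp: sets_restrict_space_iff)
  show "bdd_measurable half_line (\<lambda>s. cut_orbit x y s * f s)"
    by (intro bdd_measurable_mult bdd_measurable_cut_orbit assms)
  show "(\<lambda>s. cinner (T s x) y * f s) \<in> borel_measurable half_line"
    using assms by (intro borel_measurable_times measurable_orbit) (simp add: bdd_measurable_def)
qed (auto simp: cut_orbit_def null)

text \<open>Shows that the definite description in the weak integral denotes: existence by Riesz
  representation, uniqueness because the form separates vectors.\<close>

lemma phillips_calculus_eq:
  "cinner (phillips_calculus T \<mu> x) y = cm_integral half_line \<mu> (cut_orbit x y)"
proof -
  have orbit: "cm_integral half_line \<mu> (\<lambda>s. cinner (T s x) z) = cm_integral half_line \<mu> (cut_orbit x z)" for z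
    using cm_integral_cut[OF bdd_measurable_const[of _ 1]] by simp
  \<comment> \<open>The integral is antilinear in \<open>z\<close>; its conjugate is linear, as
    Riesz representation requires.\<close>
  have "\<exists>w. \<forall>z. cnj (cm_integral half_line \<mu> (cut_orbit x z)) = cinner z w"
  proof (rule riesz_representation)
    fix z z'
    have "cut_orbit x (z + z') = (\<lambda>s. cut_orbit x z s + cut_orbit x z' s)"
      by (auto simp: cut_orbit_def cinner_add_right algebra_simps)
    then show "cnj (cm_integral half_line \<mu> (cut_orbit x (z + z')))
        = cnj (cm_integral half_line \<mu> (cut_orbit x z)) + cnj (cm_integral half_line \<mu> (cut_orbit x z'))"
      by (simp add: cm_integral_add bdd_measurable_cut_orbit)
  next
    fix c z
    have "cut_orbit x (c *\<^sub>C z) = (\<lambda>s. cnj c * cut_orbit x z s)"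
      by (auto simp: cut_orbit_def cinner_scaleC_right)
    then show "cnj (cm_integral half_line \<mu> (cut_orbit x (c *\<^sub>C z))) = c * cnj (cm_integral half_line \<mu> (cut_orbit x z))"
      by (simp add: cm_integral_cmult)
  next
    fix z
    show "cmod (cnj (cm_integral half_line \<mu> (cut_orbit x z))) \<le> tv * (M * (1 + b) powr \<alpha> * norm x) * norm z"
      using cm_integral_bound[OF bdd_measurable_cut_orbit cmod_cut_orbit_le, of x z] by (simp add: mult.assoc)
  qed
  then obtain w where w: "\<And>z. cm_integral half_line \<mu> (cut_orbit x z) = cinner w z"
    by (metis cinner_commute complex_cnj_cnj)
  have "phillips_calculus T \<mu> x = w"
    unfolding phillips_calculus_def cm_integral_vec_def orbit w
    by (rule the_equality) (auto intro: cinner_eqI)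
  then show ?thesis
    by (simp add: w)
qed

text \<open>The block estimate with growth bounds at the times \<open>a\<close> and
  \<open>4 * a\<close>; each contributes one factor \<open>M\<close>.\<close>

lemma weighted_block_bound:
  "ennreal (cmod (cm_integral half_line \<mu> (\<lambda>s. cut_orbit x y s * of_real (phi n s))))
    \<le> ennreal (2 * 9 powr \<alpha> * M\<^sup>2 * norm x * norm y)
      * (ennreal (if n < 0 then 1 else 2 powr (real_of_int n * (2 * \<alpha>)))
        * Hinf_norm (laplace (cm_density half_line (\<lambda>t. of_real (phi n t)) \<mu>)))"
    (is "_ \<le> ennreal ?D * (ennreal ?w * ?h)")
proof -
  define a where "a = (2 powi (n - 1) :: real)"
  have a: "0 < a"
    by (simp add: a_def)
  interpret \<nu>: half_line_measure "cm_density half_line (\<lambda>s. of_real (phi n s)) \<mu>"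
    unfolding half_line_measure_def by (rule cm_density_complex_measure[OF bdd_measurable_phi])
  have "cmod (cm_integral half_line \<mu> (\<lambda>s. cut_orbit x y s * of_real (phi n s)))
      \<le> 2 * (M * (1 + a) powr \<alpha>) * (M * (1 + 4 * a) powr \<alpha>) * norm x * norm y * enn2real ?h"
    unfolding cm_integral_cut[OF bdd_measurable_phi, symmetric]
    using M unfolding a_def by (intro dyadic_block_bound[OF T] norm_le_growth) auto
  also have "\<dots> = 2 * M\<^sup>2 * norm x * norm y * enn2real ?h * ((1 + a) powr \<alpha> * (1 + 4 * a) powr \<alpha>)"
    by (simp add: power2_eq_square)
  also have "\<dots> \<le> 2 * M\<^sup>2 * norm x * norm y * enn2real ?h * (9 powr \<alpha> * ?w)"
    unfolding a_def by (intro mult_left_mono dyadic_weight_bound \<alpha>) auto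
  also have "\<dots> = ?D * (?w * enn2real ?h)"
    by simp
  finally have "ennreal (cmod (cm_integral half_line \<mu> (\<lambda>s. cut_orbit x y s * of_real (phi n s))))
      \<le> ennreal (?D * (?w * enn2real ?h))"
    by (rule ennreal_leI)
  also have "\<dots> = ennreal ?D * (ennreal ?w * ennreal (enn2real ?h))"
    by (simp add: ennreal_mult del: ennreal_enn2real)
  finally show ?thesis
    using \<nu>.Hinf_norm_laplace_finite by simp
qed

text \<open>The indicator of \<open>{0}\<close> and the functions \<open>phi n\<close> form a
  partition of unity on the half-line. The atom at 0 matches the value at infinity in the Besov
  norm, each block one summand.\<close>

lemma cmod_integral_cut_orbit_le:
  "ennreal (cmod (cm_integral half_line \<mu> (cut_orbit x y)))
    \<le> ennreal (2 * 9 powr \<alpha> * M\<^sup>2 * norm x * norm y) * besov_norm (2 * \<alpha>) \<mu>"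
    (is "_ \<le> ennreal ?D * ?B")
proof -
  define h where "h n = Hinf_norm (laplace (cm_density half_line (\<lambda>t. of_real (phi n t)) \<mu>))" for n
  \<comment> \<open>A single weight covers both sums of the Besov norm, with value 1 for negative
    \<open>n\<close>.\<close>
  define wh where "wh n = ennreal (if n < 0 then 1 else 2 powr (real_of_int n * (2 * \<alpha>))) * h n" for n
  define J where "J n = cm_integral half_line \<mu> (\<lambda>s. cut_orbit x y s * of_real (phi n s))" for n
  define J0 where "J0 = cut_orbit x y 0 * \<mu> {0}"
  have zero: "{0} \<in> sets half_line"
    by (simp add: sets_restrict_space_iff)
  have J0: "cm_integral half_line \<mu> (\<lambda>s. cut_orbit x y 0 * indicator {0} s) = J0"
    by (simp add: cm_integral_cmult cm_integral_indicator[OF zero] J0_def)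
  define S where "S N s = (\<Sum>n\<in>{- int N..int N}. phi n s)" for N s
  define G where "G N s = cut_orbit x y 0 * indicator {0} s + (\<Sum>n\<in>{- int N..int N}. cut_orbit x y s * of_real (phi n s))" for N s
  have G_eq: "G N s = (indicator {0} s + of_real (S N s)) * cut_orbit x y s" for N s
    by (auto simp: G_def S_def indicator_def distrib_left distrib_right sum_distrib_left sum_distrib_right mult.commute)
  have zero_m: "bdd_measurable half_line (\<lambda>s. cut_orbit x y 0 * indicator {0} s)"
    by (rule bdd_measurable_mult[OF bdd_measurable_const bdd_measurable_indicator[OF zero]])
  have phi_m: "bdd_measurable half_line (\<lambda>s. cut_orbit x y s * of_real (phi n s))" for n
    by (intro bdd_measurable_mult bdd_measurable_cut_orbit bdd_measurable_phi)
  have Gm: "bdd_measurable half_line (G N)" for N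
    unfolding G_def by (intro bdd_measurable_add bdd_measurable_sum zero_m phi_m)
  have int_G: "cm_integral half_line \<mu> (G N) = J0 + (\<Sum>n\<in>{- int N..int N}. J n)" for N
    unfolding G_def J_def J0[symmetric]
    by (simp add: cm_integral_add cm_integral_sum bdd_measurable_sum zero_m phi_m)
  have "(\<lambda>N. cm_integral half_line \<mu> (G N)) \<longlonglongrightarrow> cm_integral half_line \<mu> (cut_orbit x y)"
  proof (rule cm_integral_tendsto[OF Gm bdd_measurable_cut_orbit])
    fix N s assume "s \<in> space half_line"
    then have s: "0 \<le> s"
      by simp
    have "\<bar>S N s\<bar> \<le> 1"
      unfolding S_def sum_phi using ramp_bounds[of "- int N" s] ramp_bounds[of "int N + 1" s] by linarith
    then have "cmod (indicator {0} s + of_real (S N s)) \<le> 1 + 1"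
      by (intro order_trans[OF norm_triangle_ineq] add_mono) (auto simp: indicator_def)
    then show "cmod (G N s) \<le> 2 * (M * (1 + b) powr \<alpha> * norm x * norm y)"
      unfolding G_eq norm_mult using cmod_cut_orbit_le[OF s, of x y] by (intro mult_mono) auto
  next
    fix s assume "s \<in> space half_line"
    then have s: "0 \<le> s"
      by simp
    have "(\<lambda>N. indicator {0} s + complex_of_real (S N s)) \<longlonglongrightarrow> 1"
    proof (cases "s = 0")
      \<comment> \<open>Every \<open>phi n\<close> vanishes at 0, so there the indicator alone
        supplies the value 1.\<close>
      case True
      then have "S N s = 0" for N
        unfolding S_def sum_phi by (simp add: ramp_def)
      then show ?thesis
        using True by simp
    next
      case False
      then have "(\<lambda>N. complex_of_real (S N s)) \<longlonglongrightarrow> of_real 1"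
        unfolding S_def using s by (intro tendsto_of_real sum_phi_tendsto) simp
      then show ?thesis
        using False by simp
    qed
    from tendsto_mult[OF this tendsto_const[of "cut_orbit x y s"]]
    show "(\<lambda>N. G N s) \<longlonglongrightarrow> cut_orbit x y s"
      unfolding G_eq by simp
  qed
  then have lim: "(\<lambda>N. ennreal (cmod (J0 + (\<Sum>n\<in>{- int N..int N}. J n))))
      \<longlonglongrightarrow> ennreal (cmod (cm_integral half_line \<mu> (cut_orbit x y)))"
    unfolding int_G by (intro tendsto_ennrealI tendsto_norm)
  have besov: "?B = ennreal (cmod (\<mu> {0})) + (\<Sum>\<^sub>\<infinity>n\<in>{n. n < 0}. wh n) + (\<Sum>\<^sub>\<infinity>n\<in>{n. n \<ge> 0}. wh n)"
  proof -
    have "Lim at_top (\<lambda>t::real. laplace \<mu> (of_real t)) = \<mu> {0}"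
      by (rule tendsto_Lim[OF trivial_limit_at_top_linorder laplace_tendsto])
    moreover have "(\<Sum>\<^sub>\<infinity>n\<in>{n. n < 0}. wh n) = (\<Sum>\<^sub>\<infinity>n\<in>{n. n < 0}. h n)"
      by (rule infsum_cong) (simp add: wh_def)
    moreover have "(\<Sum>\<^sub>\<infinity>n\<in>{n. n \<ge> 0}. wh n)
        = (\<Sum>\<^sub>\<infinity>n\<in>{n. n \<ge> 0}. ennreal (2 powr (real_of_int n * (2 * \<alpha>))) * h n)"
      by (rule infsum_cong) (simp add: wh_def)
    ultimately show ?thesis
      by (simp add: besov_norm_def h_def[abs_def] Let_def)
  qed
  have partial: "ennreal (cmod (J0 + (\<Sum>n\<in>{- int N..int N}. J n))) \<le> ennreal ?D * ?B" for N
  proof -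
    \<comment> \<open>The atom costs only \<open>norm x * norm y\<close>; this is absorbed in the
      common constant because \<open>9 powr \<alpha>\<close> and \<open>M\<close> are at least
      1.\<close>
    have "1 * 1 * 1 * (norm x * norm y) \<le> 2 * 9 powr \<alpha> * M\<^sup>2 * (norm x * norm y)"
      using M \<alpha> by (intro mult_right_mono mult_mono one_le_power ge_one_powr_ge_zero) auto
    then have nn: "norm x * norm y \<le> ?D"
      by (simp add: mult_ac)
    have "cmod (cut_orbit x y 0) \<le> norm x * norm y"
      by (auto simp: cut_orbit_def C0_semigroupD(3)[OF T] indicator_def cmod_cinner_le)
    then have "cmod J0 \<le> ?D * cmod (\<mu> {0})"
      unfolding J0_def norm_mult using nn by (intro mult_right_mono) auto
    then have J0_le: "ennreal (cmod J0) \<le> ennreal ?D * ennreal (cmod (\<mu> {0}))"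
      by (simp add: ennreal_leI flip: ennreal_mult)
    have "ennreal (cmod (J0 + (\<Sum>n\<in>{- int N..int N}. J n)))
        \<le> ennreal (cmod J0 + (\<Sum>n\<in>{- int N..int N}. cmod (J n)))"
      by (intro ennreal_leI order_trans[OF norm_triangle_ineq] add_mono norm_sum order_refl)
    also have "\<dots> = ennreal (cmod J0) + (\<Sum>n\<in>{- int N..int N}. ennreal (cmod (J n)))"
      by (simp add: sum_nonneg)
    also have "\<dots> \<le> ennreal ?D * ennreal (cmod (\<mu> {0})) + (\<Sum>n\<in>{- int N..int N}. ennreal ?D * wh n)"
      unfolding J_def wh_def h_def by (intro add_mono sum_mono weighted_block_bound J0_le[unfolded J_def])
    also have "\<dots> = ennreal ?D * (ennreal (cmod (\<mu> {0})) + (\<Sum>n\<in>{- int N..int N}. wh n))"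
      by (simp add: distrib_left sum_distrib_left)
    also have "(\<Sum>n\<in>{- int N..int N}. wh n) = (\<Sum>n\<in>{- int N..<0}. wh n) + (\<Sum>n\<in>{0..int N}. wh n)"
      by (subst sum.union_disjoint[symmetric]) (auto intro!: sum.cong)
    also have "ennreal ?D * (ennreal (cmod (\<mu> {0})) + \<dots>) \<le> ennreal ?D * ?B"
      unfolding besov add.assoc by (intro mult_left_mono add_mono sum_le_infsum_ennreal) auto
    finally show ?thesis .
  qed
  show ?thesis
    by (rule LIMSEQ_le_const2[OF lim]) (use partial in blast)
qed

text \<open>The estimate of the form is tested with \<open>y\<close> equal to the image of
  \<open>x\<close>, and one factor of its norm is cancelled.\<close>

lemma onorm_phillips_calculus_le:
  "ennreal (onorm (phillips_calculus T \<mu>)) \<le> ennreal (2 * 9 powr \<alpha> * M\<^sup>2) * besov_norm (2 * \<alpha>) \<mu>"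
proof (cases "besov_norm (2 * \<alpha>) \<mu>" rule: ennreal_cases)
  case (real B)
  define D where "D = 2 * 9 powr \<alpha> * M\<^sup>2"
  have D: "0 \<le> D"
    by (simp add: D_def)
  have "norm (phillips_calculus T \<mu> x) \<le> D * B * norm x" for x
  proof -
    define w where "w = phillips_calculus T \<mu> x"
    have "ennreal (cmod (cinner w w)) \<le> ennreal (D * norm x * norm w) * ennreal B"
      using cmod_integral_cut_orbit_le[of x w] unfolding w_def phillips_calculus_eq real D_def .
    also have "\<dots> = ennreal (D * norm x * norm w * B)"
      using D real by (simp add: ennreal_mult)
    finally have "(norm w)\<^sup>2 \<le> D * norm x * norm w * B"
      using D real by (simp add: cinner_self del: of_real_power)
    then have "norm w * norm w \<le> (D * B * norm x) * norm w"
      by (simp add: power2_eq_square mult_ac)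
    then have "norm w \<le> D * B * norm x"
      using D real by (cases "w = 0") auto
    then show ?thesis
      unfolding w_def .
  qed
  then have "onorm (phillips_calculus T \<mu>) \<le> D * B"
    using D real by (intro onorm_bound) auto
  then have "ennreal (onorm (phillips_calculus T \<mu>)) \<le> ennreal (D * B)"
    by (rule ennreal_leI)
  then show ?thesis
    using D real by (simp add: ennreal_mult D_def)
next
  \<comment> \<open>The constant in front is positive, so the right-hand side is infinite.\<close>
  case top
  then show ?thesis
    using M by (simp add: ennreal_mult_top)
qed

end

end

theorem theorem5p3:
  shows "\<exists>c::real. 0 \<le> c \<and> c \<le> 2 \<and>
    (\<forall>(T :: real \<Rightarrow> 'a::chilbert_space \<Rightarrow> 'a) (A :: ('a \<times> 'a) set) (\<alpha>::real) (M::real).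
       C0_semigroup T \<longrightarrow> minus_op A = generator T \<longrightarrow> 0 \<le> \<alpha> \<longrightarrow> 1 \<le> M \<longrightarrow>
       (\<forall>s\<ge>0. onorm (T s) \<le> M * (1 + s) powr \<alpha>) \<longrightarrow>
       (\<forall>\<mu> :: real set \<Rightarrow> complex. bounded_complex_measure half_line \<mu> \<longrightarrow> compact_support \<mu> \<longrightarrow>
          ennreal (onorm (phillips_calculus T \<mu>))
            \<le> ennreal (c * 9 powr \<alpha> * M\<^sup>2) * besov_norm (2 * \<alpha>) \<mu>))"
\<comment> \<open>The value 2 comes from the square root of the ratio \<open>4 * a / a\<close> of
  the two orbit lengths in the block estimate.\<close>
proof (intro exI[of _ 2] conjI allI impI)
  fix T :: "real \<Rightarrow> 'a \<Rightarrow> 'a" and A :: "('a \<times> 'a) set" and \<alpha> M :: real and \<mu> :: "real set \<Rightarrow> complex"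
  assume T: "C0_semigroup T" and "0 \<le> \<alpha>" "1 \<le> M"
    and growth: "\<forall>s\<ge>0. onorm (T s) \<le> M * (1 + s) powr \<alpha>"
    and \<mu>: "bounded_complex_measure half_line \<mu>" "compact_support \<mu>"
  interpret half_line_measure \<mu>
    by unfold_locales (rule \<mu>(1))
  obtain b where b: "0 \<le> b" "\<And>B. B \<in> sets half_line \<Longrightarrow> B \<subseteq> {b<..} \<Longrightarrow> \<mu> B = 0"
    using compact_support_bounded[OF \<mu>(2)] by blast
  have "norm (T s x) \<le> M * (1 + s) powr \<alpha> * norm x" if "0 \<le> s" for s x
    using onorm[OF C0_semigroupD(1)[OF T that], of x] growth that
      mult_right_mono[of "onorm (T s)" "M * (1 + s) powr \<alpha>" "norm x"] by force
  then show "ennreal (onorm (phillips_calculus T \<mu>))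
      \<le> ennreal (2 * 9 powr \<alpha> * M\<^sup>2) * besov_norm (2 * \<alpha>) \<mu>"
    using T \<open>0 \<le> \<alpha>\<close> \<open>1 \<le> M\<close> b by (intro onorm_phillips_calculus_le[of T \<alpha> M b])
qed auto

end
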